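(* Let $D,k>0$, $0<\alpha\leq1$, $n\geq2$. Let $\Omega\subset\mathbb{R}^n$ be a bounded Lipschitz domain of diameter at most $D$ and let $V\in C^\alpha(\overline\Omega)$ with $\inf_{\partial\Omega}|V|>0$. Suppose $k$ is an interior transmission eigenvalue and $u,w\in L^2(\Omega)$ is a pair of transmission eigenfunctions associated with $k$. If $u\in C^\alpha(\overline\Omega)$ and $\|u\|_{C^\alpha(\overline\Omega)}=1$, then \[ \sup_{\partial\Omega}|u|\leq\mathcal C\,\big(\operatorname{diam}(\Omega)\big)^\alpha\,\|V\|_{C^\alpha(\overline\Omega)}\big/\inf_{\partial\Omega}|V|, \] where $\mathcal C$ is a positive constant depending only on $\alpha,D,k,n$.
   Context: Interior transmission problem: $k>0$ is an interior transmission eigenvalue for $(\Omega,V)$ if there exist nontrivial $w,u\in L^2(\Omega)$ with $(\Delta+k^2)w=0$ in $\Omega$, $(\Delta+k^2(1+V))u=0$ in $\Omega$, and $u-w\in H^2_0(\Omega)$; $(u,w)$ are then called transmission eigenfunctions. Standing assumption: bounded domains satisfy $H^2_0(\Omega)=\{u|_\Omega: u\in H^2(\mathbb{R}^n),\ u=0 \text{ in } \mathbb{R}^n\setminus\overline\Omega\}$. *)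

theory Defs
  imports "HOL-Analysis.Analysis"
begin

definition partial :: "'n::finite \<Rightarrow> (real^'n \<Rightarrow> real) \<Rightarrow> real^'n \<Rightarrow> real" where
  "partial i f x = deriv (\<lambda>t. f (x + t *\<^sub>R axis i 1)) 0"

fun iter_partial :: "'n::finite list \<Rightarrow> (real^'n \<Rightarrow> real) \<Rightarrow> real^'n \<Rightarrow> real" where
  "iter_partial [] f = f"
| "iter_partial (i # is) f = partial i (iter_partial is f)"

definition smooth_fun :: "(real^'n::finite \<Rightarrow> real) \<Rightarrow> bool" where
  "smooth_fun f \<longleftrightarrow> (\<forall>is. (\<forall>x. iter_partial is f differentiable (at x)))"

definition fsupport :: "(real^'n::finite \<Rightarrow> real) \<Rightarrow> (real^'n) set" where
  "fsupport f = closure {x. f x \<noteq> 0}"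

definition test_fun_on :: "(real^'n::finite) set \<Rightarrow> (real^'n \<Rightarrow> real) \<Rightarrow> bool" where
  "test_fun_on S f \<longleftrightarrow> smooth_fun f \<and> compact (fsupport f) \<and> fsupport f \<subseteq> S"

definition laplacian :: "(real^'n::finite \<Rightarrow> real) \<Rightarrow> real^'n \<Rightarrow> real" where
  "laplacian f x = (\<Sum>i\<in>UNIV. partial i (partial i f) x)"

definition L2_on :: "(real^'n::finite) set \<Rightarrow> (real^'n \<Rightarrow> complex) \<Rightarrow> bool" where
  "L2_on S f \<longleftrightarrow> set_borel_measurable lebesgue S f
      \<and> set_integrable lebesgue S (\<lambda>x. (cmod (f x))^2)"

definition H2 :: "(real^'n::finite \<Rightarrow> complex) \<Rightarrow> bool" where
  "H2 F \<longleftrightarrow> L2_on UNIV F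
     \<and> (\<forall>i. \<exists>G. L2_on UNIV G \<and> (\<forall>\<phi>. test_fun_on UNIV \<phi> \<longrightarrow>
           (LINT x|lebesgue. F x * of_real (partial i \<phi> x)) = - (LINT x|lebesgue. G x * of_real (\<phi> x))))
     \<and> (\<forall>i j. \<exists>G. L2_on UNIV G \<and> (\<forall>\<phi>. test_fun_on UNIV \<phi> \<longrightarrow>
           (LINT x|lebesgue. F x * of_real (partial i (partial j \<phi>) x)) = (LINT x|lebesgue. G x * of_real (\<phi> x))))"

definition H2_0 :: "(real^'n::finite) set \<Rightarrow> (real^'n \<Rightarrow> complex) \<Rightarrow> bool" where
  "H2_0 \<Omega> f \<longleftrightarrow> (\<exists>F. H2 F \<and> (AE x in lebesgue. x \<notin> closure \<Omega> \<longrightarrow> F x = 0)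
                        \<and> (AE x in lebesgue. x \<in> \<Omega> \<longrightarrow> F x = f x))"

definition weak_helmholtz :: "(real^'n::finite) set \<Rightarrow> real \<Rightarrow> (real^'n \<Rightarrow> complex) \<Rightarrow> (real^'n \<Rightarrow> complex) \<Rightarrow> bool" where
  "weak_helmholtz \<Omega> k q u \<longleftrightarrow> (\<forall>\<phi>. test_fun_on \<Omega> \<phi> \<longrightarrow>
      (LINT x:\<Omega>|lebesgue. u x * (of_real (laplacian \<phi> x) + (of_real k)^2 * q x * of_real (\<phi> x))) = 0)"

definition transmission_eigenfunctions ::
  "(real^'n::finite) set \<Rightarrow> (real^'n \<Rightarrow> complex) \<Rightarrow> real \<Rightarrow> (real^'n \<Rightarrow> complex) \<Rightarrow> (real^'n \<Rightarrow> complex) \<Rightarrow> bool" where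
  "transmission_eigenfunctions \<Omega> V k u w \<longleftrightarrow>
     k > 0 \<and> L2_on \<Omega> u \<and> L2_on \<Omega> w
     \<and> \<not> (AE x in lebesgue. x \<in> \<Omega> \<longrightarrow> u x = 0)
     \<and> \<not> (AE x in lebesgue. x \<in> \<Omega> \<longrightarrow> w x = 0)
     \<and> weak_helmholtz \<Omega> k (\<lambda>x. 1) w
     \<and> weak_helmholtz \<Omega> k (\<lambda>x. 1 + V x) u
     \<and> H2_0 \<Omega> (\<lambda>x. u x - w x)"

definition interior_transmission_eigenvalue :: "(real^'n::finite) set \<Rightarrow> (real^'n \<Rightarrow> complex) \<Rightarrow> real \<Rightarrow> bool" where
  "interior_transmission_eigenvalue \<Omega> V k \<longleftrightarrow> (\<exists>u w. transmission_eigenfunctions \<Omega> V k u w)"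

definition holder_on :: "real \<Rightarrow> (real^'n::finite) set \<Rightarrow> (real^'n \<Rightarrow> complex) \<Rightarrow> bool" where
  "holder_on \<alpha> S f \<longleftrightarrow> bounded (f ` S)
      \<and> (\<exists>C. \<forall>x\<in>S. \<forall>y\<in>S. cmod (f x - f y) \<le> C * dist x y powr \<alpha>)"

definition holder_norm :: "real \<Rightarrow> (real^'n::finite) set \<Rightarrow> (real^'n \<Rightarrow> complex) \<Rightarrow> real" where
  "holder_norm \<alpha> S f = (SUP x\<in>S. cmod (f x))
      + (SUP p\<in>{(x,y). x \<in> S \<and> y \<in> S \<and> x \<noteq> y}. cmod (f (fst p) - f (snd p)) / dist (fst p) (snd p) powr \<alpha>)"

text \<open>Near each boundary point, Omega is the region below the graph of a Lipschitz function
  over the hyperplane orthogonal to some unit vector nu (g is constant along nu).\<close>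
definition lipschitz_domain :: "(real^'n::finite) set \<Rightarrow> bool" where
  "lipschitz_domain \<Omega> \<longleftrightarrow> open \<Omega> \<and> connected \<Omega> \<and> \<Omega> \<noteq> {} \<and>
     (\<forall>p\<in>frontier \<Omega>. \<exists>r>0. \<exists>\<nu> g L. norm \<nu> = 1 \<and> L-lipschitz_on UNIV g
        \<and> (\<forall>x t. g (x + t *\<^sub>R \<nu>) = g x)
        \<and> \<Omega> \<inter> ball p r = {x \<in> ball p r. x \<bullet> \<nu> < g x})"

end

theory Submission
  imports Defs
begin

text \<open>
  Let \<open>F\<close> be the \<open>H\<^sup>2\<close> extension of \<open>u - w\<close> by zero. Subtracting the two Helmholtz equations gives
  \<open>(\<Delta> + k\<^sup>2) F = - k\<^sup>2 1\<^bsub>\<Omega>\<^esub> V u\<close> almost everywhere, first off the boundary by the fundamental lemma of the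
  calculus of variations, then everywhere because a Lipschitz boundary is a null set. Testing with a
  compactly supported function that equals the Helmholtz solution \<open>cos (k (x\<^sub>1 - p\<^sub>1))\<close> near the closure of
  \<open>\<Omega>\<close>, for a boundary point \<open>p\<close>, yields \<open>\<integral>\<^bsub>\<Omega>\<^esub> V u cos (k (x\<^sub>1 - p\<^sub>1)) = 0\<close>. If \<open>k diam \<Omega> \<le> 1\<close>, the cosine
  is at least \<open>1/2\<close> on \<open>\<Omega>\<close>, so \<open>|V(p) u(p)|\<close> is at most twice the oscillation of \<open>V u\<close>, which the
  Hoelder norms bound by \<open>diam(\<Omega>)\<^sup>\<alpha> \<parallel>V\<parallel>\<close>. If \<open>k diam \<Omega> > 1\<close>, the bound is trivial for the constant
  \<open>k\<^sup>\<alpha>\<close>, since \<open>|u| \<le> 1\<close> and \<open>inf |V| \<le> \<parallel>V\<parallel>\<close>.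
\<close>

section \<open>Smooth functions of one variable\<close>

text \<open>Derivatives are given by witnesses rather than by \<open>deriv\<close>: each closure
  rule below is then an induction on \<open>n\<close> that only has to exhibit a derivative.\<close>

primrec diffn :: "nat \<Rightarrow> (real \<Rightarrow> real) \<Rightarrow> bool" where
  "diffn 0 f \<longleftrightarrow> True"
| "diffn (Suc n) f \<longleftrightarrow> (\<exists>f'. (\<forall>x. (f has_real_derivative f' x) (at x)) \<and> diffn n f')"

definition smooth1 :: "(real \<Rightarrow> real) \<Rightarrow> bool" where
  "smooth1 f \<longleftrightarrow> (\<forall>n. diffn n f)"

lemma diffn_SucD: "diffn (Suc n) f \<Longrightarrow> diffn n f"
proof (induction n arbitrary: f)
  case (Suc n)
  from Suc.prems obtain f' where "\<forall>x. (f has_real_derivative f' x) (at x)" "diffn (Suc n) f'"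
    unfolding diffn.simps(2)[of "Suc n"] by blast
  with Suc.IH show ?case unfolding diffn.simps(2)[of n] by blast
qed simp

lemma diffn_const: "diffn n (\<lambda>x. c)"
proof (induction n arbitrary: c)
  case (Suc n)
  then show ?case
    by (auto intro!: exI[of _ "\<lambda>x. 0"])
qed simp

lemma diffn_add: "diffn n f \<Longrightarrow> diffn n g \<Longrightarrow> diffn n (\<lambda>x. f x + g x)"
proof (induction n arbitrary: f g)
  case (Suc n)
  then obtain f' g' where "\<forall>x. (f has_real_derivative f' x) (at x)" "diffn n f'"
    "\<forall>x. (g has_real_derivative g' x) (at x)" "diffn n g'"
    by auto
  then show ?case
    using Suc.IH[of f' g'] by (auto intro!: exI[of _ "\<lambda>x. f' x + g' x"] derivative_eq_intros)
qed simp

lemma diffn_mult: "diffn n f \<Longrightarrow> diffn n g \<Longrightarrow> diffn n (\<lambda>x. f x * g x)"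
proof (induction n arbitrary: f g)
  case (Suc n)
  then obtain f' g' where f': "\<forall>x. (f has_real_derivative f' x) (at x)" "diffn n f'"
    and g': "\<forall>x. (g has_real_derivative g' x) (at x)" "diffn n g'"
    by auto
  \<comment> \<open>The product rule keeps \<open>f\<close> and \<open>g\<close> themselves, so
    their order is lowered with \<open>diffn_SucD\<close> before the induction hypothesis
    applies.\<close>
  have "diffn n (\<lambda>x. f' x * g x + f x * g' x)"
    using Suc.IH[OF f'(2) diffn_SucD[OF Suc.prems(2)]] Suc.IH[OF diffn_SucD[OF Suc.prems(1)] g'(2)]
    by (rule diffn_add)
  then show ?case
    using f' g' by (auto intro!: exI[of _ "\<lambda>x. f' x * g x + f x * g' x"] derivative_eq_intros)
qed simp

text \<open>The derivative -g'/g^2 is a product of \<open>g'\<close> and two copies of the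
  reciprocal, so order \<open>n\<close> of the reciprocal yields order \<open>Suc n\<close>.\<close>

lemma diffn_inverse:
  assumes "\<And>x. g x \<noteq> 0"
  shows "diffn n g \<Longrightarrow> diffn n (\<lambda>x. inverse (g x))"
proof (induction n)
  case (Suc n)
  then obtain g' where g': "\<forall>x. (g has_real_derivative g' x) (at x)" "diffn n g'"
    by auto
  have i: "diffn n (\<lambda>x. inverse (g x))"
    using Suc.IH[OF diffn_SucD[OF Suc.prems]] .
  have "diffn n (\<lambda>x. (-1) * (inverse (g x) * (g' x * inverse (g x))))"
    by (intro diffn_mult diffn_const i g'(2))
  moreover have "((\<lambda>x. inverse (g x)) has_real_derivative (-1) * (inverse (g x) * (g' x * inverse (g x)))) (at x)" for x
    using DERIV_inverse'[OF g'(1)[rule_format] assms] by (simp add: mult.assoc)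
  ultimately show ?case unfolding diffn.simps
    by (intro exI[of _ "\<lambda>x. (-1) * (inverse (g x) * (g' x * inverse (g x)))"] conjI allI)
qed simp

lemma diffn_affine: "diffn n f \<Longrightarrow> diffn n (\<lambda>x. f (c * x + d))"
proof (induction n arbitrary: f)
  case (Suc n)
  then obtain f' where f': "\<forall>x. (f has_real_derivative f' x) (at x)" "diffn n f'"
    by auto
  have "diffn n (\<lambda>x. f' (c * x + d) * c)"
    by (intro diffn_mult diffn_const Suc.IH f'(2))
  moreover have "((\<lambda>x. f (c * x + d)) has_real_derivative f' (c * x + d) * c) (at x)" for x
    by (rule DERIV_chain2[OF f'(1)[rule_format]]) (auto intro!: derivative_eq_intros)
  ultimately show ?case
    by (auto intro!: exI[of _ "\<lambda>x. f' (c * x + d) * c"])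
qed simp

text \<open>Both coefficients stay general because differentiation maps (a, b) to (b, -a): the
  induction runs over the whole span of cosine and sine.\<close>

lemma diffn_sin_cos: "diffn n (\<lambda>x. a * cos x + b * sin x)"
proof (induction n arbitrary: a b)
  case (Suc n)
  have "((\<lambda>x. a * cos x + b * sin x) has_real_derivative b * cos x + (- a) * sin x) (at x)" for x
    by (auto intro!: derivative_eq_intros)
  with Suc.IH[of b "- a"] show ?case unfolding diffn.simps(2)
    by (intro exI[of _ "\<lambda>x. b * cos x + (- a) * sin x"]) blast
qed simp

lemma smooth1_cos: "smooth1 cos"
  unfolding smooth1_def using diffn_sin_cos[of _ 1 0] by simp

lemma smooth1_mult: "smooth1 f \<Longrightarrow> smooth1 g \<Longrightarrow> smooth1 (\<lambda>x. f x * g x)"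
  by (simp add: smooth1_def diffn_mult)

lemma smooth1_affine: "smooth1 f \<Longrightarrow> smooth1 (\<lambda>x. f (c * x + d))"
  by (simp add: smooth1_def diffn_affine)

lemma smooth1_has_derivative:
  assumes "smooth1 f"
  shows "(f has_real_derivative deriv f x) (at x)"
proof -
  have "diffn (Suc 0) f" using assms unfolding smooth1_def by blast
  then obtain f' where "\<And>x. (f has_real_derivative f' x) (at x)" by auto
  then show ?thesis by (metis DERIV_imp_deriv)
qed

lemma smooth1_deriv:
  assumes "smooth1 f"
  shows "smooth1 (deriv f)"
  unfolding smooth1_def
proof
  fix n
  have "diffn (Suc n) f" using assms unfolding smooth1_def by blast
  then obtain f' where f': "\<And>x. (f has_real_derivative f' x) (at x)" "diffn n f'" by auto
  have "deriv f = f'" using DERIV_imp_deriv[OF f'(1)] by blast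
  with f' show "diffn n (deriv f)" by simp
qed

text \<open>
  The functions \<open>p (1/x) exp (-1/x)\<close>, for all polynomials \<open>p\<close> at once: the family is closed under
  differentiation, which gives smoothness at \<open>0\<close> by induction.
\<close>
definition flat_exp :: "real poly \<Rightarrow> real \<Rightarrow> real" where
  "flat_exp p x = (if x \<le> 0 then 0 else poly p (1 / x) * exp (- (1 / x)))"

lemma poly_exp_tendsto_0: "((\<lambda>y. poly p y * exp (- y)) \<longlongrightarrow> (0::real)) at_top"
proof -
  have "((\<lambda>y. \<Sum>i\<le>degree p. coeff p i * (y ^ i / exp y)) \<longlongrightarrow> (\<Sum>i\<le>degree p. coeff p i * 0)) at_top"
    by (intro tendsto_sum tendsto_mult tendsto_const tendsto_power_div_exp_0)
  moreover have "(\<Sum>i\<le>degree p. coeff p i * (y ^ i / exp y)) = poly p y * exp (- y)" for y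
    by (simp add: poly_altdef exp_minus sum_distrib_right divide_inverse mult.assoc)
  ultimately show ?thesis by simp
qed

text \<open>For x > 0, differentiating brings out a factor 1/x^2; the two \<open>pCons 0\<close>
  encode it as multiplication by the square of the variable. At 0 the difference quotient is handled
  directly.\<close>

lemma flat_exp_has_derivative:
  "(flat_exp p has_real_derivative flat_exp (pCons 0 (pCons 0 (p - pderiv p))) x) (at x)"
proof -
  consider "x < 0" | "x = 0" | "x > 0" by linarith
  then show ?thesis
  proof cases
    case 1
    have "((\<lambda>x. 0::real) has_real_derivative 0) (at x)" by simp
    then have "(flat_exp p has_real_derivative 0) (at x)"
      by (rule has_field_derivative_transform_within_open[where S = "{..<0}"])
        (use 1 in \<open>auto simp: flat_exp_def\<close>)
    then show ?thesis using 1 by (simp add: flat_exp_def)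
  next
    case 3
    have "((\<lambda>x. poly p (1 / x) * exp (- (1 / x))) has_real_derivative
        poly (pderiv p) (1 / x) * (- 1 / x^2) * exp (- (1 / x)) + poly p (1 / x) * (exp (- (1 / x)) * (1 / x^2))) (at x)"
      using 3 by (auto intro!: derivative_eq_intros DERIV_chain2[OF poly_DERIV] simp: power2_eq_square)
    then have "((\<lambda>x. poly p (1 / x) * exp (- (1 / x))) has_real_derivative
        flat_exp (pCons 0 (pCons 0 (p - pderiv p))) x) (at x)"
      by (rule DERIV_cong) (use 3 in \<open>simp add: flat_exp_def field_simps power2_eq_square\<close>)
    then show ?thesis
      by (rule has_field_derivative_transform_within_open[where S = "{0<..}"])
        (use 3 in \<open>auto simp: flat_exp_def\<close>)
  next
    case 2
    \<comment> \<open>With y = 1/h the difference quotient from the right is y p(y) exp(-y), hence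
      the extra factor \<open>pCons 0\<close>.\<close>
    have "((\<lambda>y. poly (pCons 0 p) y * exp (- y)) \<longlongrightarrow> 0) at_top"
      by (rule poly_exp_tendsto_0)
    moreover have "filterlim (\<lambda>h::real. inverse h) at_top (at_right 0)"
      by (rule filterlim_inverse_at_top_right)
    ultimately have "((\<lambda>h. poly (pCons 0 p) (inverse h) * exp (- inverse h)) \<longlongrightarrow> 0) (at_right 0)"
      by (rule filterlim_compose)
    moreover have "\<forall>\<^sub>F h in at_right 0. poly (pCons 0 p) (inverse h) * exp (- inverse h) = flat_exp p h / h"
      unfolding eventually_at_right_field by (rule exI[of _ 1]) (auto simp: flat_exp_def field_simps)
    ultimately have r: "((\<lambda>h. flat_exp p h / h) \<longlongrightarrow> 0) (at_right 0)"
      by (rule Lim_transform_eventually)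
    have "\<forall>\<^sub>F h in at_left 0. 0 = flat_exp p h / h"
      unfolding eventually_at_left_field by (rule exI[of _ "-1"]) (auto simp: flat_exp_def)
    then have "((\<lambda>h. flat_exp p h / h) \<longlongrightarrow> 0) (at_left 0)"
      by (rule Lim_transform_eventually[OF tendsto_const])
    with r have "((\<lambda>h. flat_exp p h / h) \<longlongrightarrow> 0) (at 0)"
      by (simp add: filterlim_at_split)
    then show ?thesis using 2 by (simp add: has_field_derivative_iff flat_exp_def)
  qed
qed

lemma smooth1_flat_exp: "smooth1 (flat_exp p)"
proof -
  have "diffn n (flat_exp p)" for n
    by (induction n arbitrary: p) (auto intro: flat_exp_has_derivative)
  then show ?thesis by (simp add: smooth1_def)
qed

section \<open>Smooth transitions and cut-offs\<close>

definition smooth_step :: "real \<Rightarrow> real" where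
  "smooth_step x = flat_exp 1 x * inverse (flat_exp 1 x + flat_exp 1 (1 - x))"

lemma flat_exp_1_pos: "x > 0 \<Longrightarrow> flat_exp 1 x > 0"
  and flat_exp_1_nonneg: "flat_exp 1 x \<ge> 0"
  by (auto simp: flat_exp_def)

text \<open>One of x and 1 - x is always positive; this makes the denominator of
  \<open>smooth_step\<close> invertible.\<close>

lemma flat_exp_sum_pos: "flat_exp 1 x + flat_exp 1 (1 - x) > 0"
proof (cases "x > 0")
  case True
  then show ?thesis using flat_exp_1_pos[of x] flat_exp_1_nonneg[of "1 - x"] by linarith
next
  case False
  then show ?thesis using flat_exp_1_pos[of "1 - x"] flat_exp_1_nonneg[of x] by linarith
qed

lemma smooth1_smooth_step: "smooth1 smooth_step"
proof -
  have "diffn n (\<lambda>x. flat_exp 1 x * inverse (flat_exp 1 x + flat_exp 1 ((-1) * x + 1)))" for n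
  proof (intro diffn_mult diffn_inverse diffn_add)
    show "flat_exp 1 x + flat_exp 1 (-1 * x + 1) \<noteq> 0" for x
      using flat_exp_sum_pos[of x] by simp
    show "diffn n (flat_exp 1)" "diffn n (flat_exp 1)" "diffn n (\<lambda>x. flat_exp 1 ((-1) * x + 1))"
      using smooth1_affine[OF smooth1_flat_exp] smooth1_flat_exp by (auto simp only: smooth1_def)
  qed
  then show ?thesis by (simp add: smooth1_def smooth_step_def[abs_def])
qed

lemma smooth_step_eq_0: "x \<le> 0 \<Longrightarrow> smooth_step x = 0"
  by (simp add: smooth_step_def flat_exp_def)

lemma smooth_step_eq_1: "x \<ge> 1 \<Longrightarrow> smooth_step x = 1"
  by (simp add: smooth_step_def flat_exp_def)

lemma smooth_step_bounds: "0 \<le> smooth_step x" "smooth_step x \<le> 1"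
  using flat_exp_sum_pos[of x] flat_exp_1_nonneg[of x] flat_exp_1_nonneg[of "1 - x"]
  by (auto simp: smooth_step_def field_simps)

text \<open>For positive \<open>\<delta>\<close>, this is the width of the transition layer inside
  each end of the interval from \<open>a\<close> to \<open>b\<close>.\<close>

definition plateau :: "real \<Rightarrow> real \<Rightarrow> real \<Rightarrow> real \<Rightarrow> real" where
  "plateau \<delta> a b x = smooth_step ((x - a) / \<delta>) * smooth_step ((b - x) / \<delta>)"

lemma smooth1_plateau: "smooth1 (plateau \<delta> a b)"
proof -
  have "smooth1 (\<lambda>x. smooth_step ((1 / \<delta>) * x + (- a / \<delta>)) * smooth_step ((- 1 / \<delta>) * x + b / \<delta>))"
    by (intro smooth1_mult smooth1_affine smooth1_smooth_step)
  moreover have "(1 / \<delta>) * x + (- a / \<delta>) = (x - a) / \<delta>"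
    "(- 1 / \<delta>) * x + b / \<delta> = (b - x) / \<delta>" for x
    by (simp_all add: diff_divide_distrib)
  ultimately show ?thesis by (simp only: plateau_def[abs_def])
qed

lemma plateau_bounds: "0 \<le> plateau \<delta> a b x" "plateau \<delta> a b x \<le> 1"
  by (auto simp: plateau_def smooth_step_bounds mult_le_one)

lemma plateau_eq_0: "\<delta> > 0 \<Longrightarrow> x \<notin> {a<..<b} \<Longrightarrow> plateau \<delta> a b x = 0"
  by (auto simp: plateau_def smooth_step_eq_0 not_less divide_le_0_iff)

lemma plateau_eq_1: "\<delta> > 0 \<Longrightarrow> x \<in> {a + \<delta>..b - \<delta>} \<Longrightarrow> plateau \<delta> a b x = 1"
  by (simp add: plateau_def smooth_step_eq_1 field_simps)

section \<open>Products of one-variable functions as test functions\<close>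

text \<open>Test functions are taken in product form: partial derivatives then act on a single
  factor, and everything reduces to calculus in one variable. Such products still suffice for the
  fundamental lemma.\<close>

definition tensor :: "('n::finite \<Rightarrow> real \<Rightarrow> real) \<Rightarrow> real^'n \<Rightarrow> real" where
  "tensor b x = (\<Prod>i\<in>UNIV. b i (x $ i))"

lemma tensor_split: "tensor b x = b i (x $ i) * (\<Prod>j\<in>UNIV - {i}. b j (x $ j))"
  unfolding tensor_def by (subst prod.remove[of _ i]) auto

lemma partial_tensor:
  fixes b :: "'n::finite \<Rightarrow> real \<Rightarrow> real"
  assumes "smooth1 (b i)"
  shows "partial i (tensor b) = tensor (b(i := deriv (b i)))"
proof
  fix x :: "real^'n"
  let ?P = "\<Prod>j\<in>UNIV - {i}. b j (x $ j)"
  have line: "tensor b (x + t *\<^sub>R axis i 1) = b i (x $ i + t) * ?P" for t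
  proof -
    have "(\<Prod>j\<in>UNIV - {i}. b j ((x + t *\<^sub>R axis i 1) $ j)) = ?P"
      by (rule prod.cong) (auto simp: axis_def)
    then show ?thesis by (simp add: tensor_split[of b _ i])
  qed
  have "((\<lambda>t. b i (x $ i + t)) has_real_derivative deriv (b i) (x $ i)) (at 0)"
    using DERIV_shift[of "b i" "deriv (b i) (x $ i)" 0 "x $ i"] smooth1_has_derivative[OF assms]
    by (simp add: add.commute)
  then have "((\<lambda>t. b i (x $ i + t) * ?P) has_real_derivative deriv (b i) (x $ i) * ?P) (at 0)"
    by (rule DERIV_cmult_right)
  then have "partial i (tensor b) x = deriv (b i) (x $ i) * ?P"
    unfolding partial_def line by (rule DERIV_imp_deriv)
  also have "\<dots> = tensor (b(i := deriv (b i))) x"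
    by (simp add: tensor_split[of _ _ i])
  finally show "partial i (tensor b) x = tensor (b(i := deriv (b i))) x" .
qed

lemma laplacian_tensor:
  assumes "\<And>i. smooth1 (b i)"
  shows "laplacian (tensor b) x = (\<Sum>i\<in>UNIV. tensor (b(i := deriv (deriv (b i)))) x)"
  using assms by (simp add: laplacian_def partial_tensor smooth1_deriv)

lemma tensor_differentiable:
  fixes b :: "'n::finite \<Rightarrow> real \<Rightarrow> real"
  assumes "\<And>i. smooth1 (b i)"
  shows "tensor b differentiable (at x)"
proof -
  have *: "(\<lambda>x::real^'n. b i (x $ i)) differentiable (at x)" for i
  proof -
    have "b i differentiable (at (x $ i))"
      using smooth1_has_derivative[OF assms] real_differentiable_def by blast
    moreover have "(\<lambda>x::real^'n. x $ i) differentiable (at x)"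
      by (intro linear_imp_differentiable bounded_linear.linear bounded_linear_vec_nth)
    ultimately show ?thesis
      using differentiable_compose[of "b i" "\<lambda>x. x $ i" x UNIV] by simp
  qed
  have "(\<lambda>x::real^'n. \<Prod>i\<in>I. b i (x $ i)) differentiable (at x)" if "finite I" for I
    using that by (induction I rule: finite_induct) (auto intro!: differentiable_mult *)
  then show ?thesis by (simp add: tensor_def[abs_def])
qed

text \<open>Every iterated partial derivative is again a product of smooth factors, and every such
  product is differentiable.\<close>

lemma smooth_fun_tensor:
  assumes "\<And>i. smooth1 (b i)"
  shows "smooth_fun (tensor b)"
proof -
  have "\<exists>b'. (\<forall>i. smooth1 (b' i)) \<and> iter_partial is (tensor b) = tensor b'" for "is"
  proof (induction "is")
    case (Cons i "is")
    then obtain b' where "\<And>i. smooth1 (b' i)" "iter_partial is (tensor b) = tensor b'" by blast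
    then have "iter_partial (i # is) (tensor b) = tensor (b'(i := deriv (b' i)))"
      "\<forall>j. smooth1 ((b'(i := deriv (b' i))) j)"
      by (simp_all only: iter_partial.simps partial_tensor) (simp add: smooth1_deriv)
    then show ?case by blast
  qed (use assms in auto)
  then show ?thesis unfolding smooth_fun_def by (metis tensor_differentiable)
qed

lemma continuous_on_tensor:
  assumes "\<And>i. smooth1 (b i)"
  shows "continuous_on S (tensor b)"
  using tensor_differentiable[of b, OF assms]
  by (simp add: continuous_at_imp_continuous_on differentiable_imp_continuous_within)

lemma tensor_eq_0:
  fixes x :: "real^'n::finite"
  assumes "\<And>i t. t \<notin> {l $ i..h $ i} \<Longrightarrow> b i t = 0" "x \<notin> cbox l h"
  shows "tensor b x = 0"
  using assms unfolding tensor_def mem_box_cart by (subst prod_zero_iff) auto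

lemma test_fun_on_tensor:
  fixes l h :: "real^'n::finite"
  assumes "\<And>i. smooth1 (b i)" "\<And>i t. t \<notin> {l $ i..h $ i} \<Longrightarrow> b i t = 0" "cbox l h \<subseteq> S"
  shows "test_fun_on S (tensor b)"
proof -
  have "{x. tensor b x \<noteq> 0} \<subseteq> cbox l h"
    using tensor_eq_0[of l h b] assms(2) by blast
  then have "fsupport (tensor b) \<subseteq> cbox l h"
    unfolding fsupport_def by (rule closure_minimal) (rule closed_cbox)
  moreover from this have "compact (fsupport (tensor b))"
    unfolding fsupport_def by (meson bounded_cbox bounded_subset closed_closure compact_eq_bounded_closed)
  ultimately show ?thesis
    using assms smooth_fun_tensor[of b] unfolding test_fun_on_def by blast
qed

section \<open>Local integrability on boxes\<close>

definition locint :: "(real^'n::finite \<Rightarrow> complex) \<Rightarrow> bool" where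
  "locint f \<longleftrightarrow> (\<forall>l h. set_integrable lebesgue (cbox l h) f)"

lemma locint_add: "locint f \<Longrightarrow> locint g \<Longrightarrow> locint (\<lambda>x. f x + g x)"
  by (simp add: locint_def set_integral_add)

lemma locint_mult: "locint f \<Longrightarrow> locint (\<lambda>x. c * f x)"
  by (simp add: locint_def set_integrable_mult_right)

lemma locint_sum: "(\<And>i. i \<in> I \<Longrightarrow> locint (f i)) \<Longrightarrow> locint (\<lambda>x. \<Sum>i\<in>I. f i x)"
  unfolding locint_def set_integrable_def scaleR_sum_right
  by (intro allI Bochner_Integration.integrable_sum) auto

text \<open>A box has finite measure, and t \<le> t^2 + 1 bounds the modulus of \<open>f\<close> by
  an integrable function there.\<close>

lemma L2_on_imp_locint:
  assumes "L2_on S f"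
  shows "locint (\<lambda>x. indicator S x *\<^sub>R f x)"
  unfolding locint_def set_integrable_def
proof (intro allI)
  fix l h :: "real^'a"
  have m: "(\<lambda>x. indicator S x *\<^sub>R f x) \<in> borel_measurable lebesgue"
    and i: "integrable lebesgue (\<lambda>x. indicator S x *\<^sub>R (cmod (f x))\<^sup>2)"
    using assms by (auto simp: L2_on_def set_borel_measurable_def set_integrable_def)
  have "integrable lebesgue (indicator (cbox l h) :: real^'a \<Rightarrow> real)"
    by (simp add: emeasure_lborel_cbox_eq)
  with i have "integrable lebesgue (\<lambda>x. indicator S x *\<^sub>R (cmod (f x))\<^sup>2 + indicator (cbox l h) x)"
    by (rule Bochner_Integration.integrable_add)
  then show "integrable lebesgue (\<lambda>x. indicator (cbox l h) x *\<^sub>R indicator S x *\<^sub>R f x)"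
  proof (rule Bochner_Integration.integrable_bound)
    show "(\<lambda>x. indicator (cbox l h) x *\<^sub>R indicator S x *\<^sub>R f x) \<in> borel_measurable lebesgue"
      by (intro borel_measurable_scaleR m borel_measurable_indicator) auto
    have "t \<le> t\<^sup>2 + 1" for t :: real
      using zero_le_power2[of "t - 1/2"] by (simp add: power2_diff power_divide)
    then show "AE x in lebesgue. norm (indicator (cbox l h) x *\<^sub>R indicator S x *\<^sub>R f x)
        \<le> norm (indicator S x *\<^sub>R (cmod (f x))\<^sup>2 + indicator (cbox l h) x)"
      by (auto simp: indicator_def)
  qed
qed

lemma locint_mult_continuous:
  fixes \<psi> :: "real^'n::finite \<Rightarrow> real"
  assumes "locint f" "continuous_on UNIV \<psi>" "\<And>x. x \<notin> cbox l h \<Longrightarrow> \<psi> x = 0"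
  shows "integrable lebesgue (\<lambda>x. f x * of_real (\<psi> x))"
proof -
  have "compact (\<psi> ` cbox l h)"
    using assms(2) by (intro compact_continuous_image compact_cbox) (auto intro: continuous_on_subset)
  then obtain B where B: "\<And>x. x \<in> cbox l h \<Longrightarrow> \<bar>\<psi> x\<bar> \<le> B"
    using compact_imp_bounded[of "\<psi> ` cbox l h"] unfolding bounded_iff by auto
  have i: "integrable lebesgue (\<lambda>x. indicator (cbox l h) x *\<^sub>R f x)"
    using assms(1) by (simp add: locint_def set_integrable_def)
  have "\<psi> \<in> borel_measurable borel"
    using assms(2) by (rule borel_measurable_continuous_onI)
  then have m: "\<psi> \<in> borel_measurable lebesgue"
    by (simp add: measurable_completion)
  have "integrable lebesgue (\<lambda>x. (indicator (cbox l h) x *\<^sub>R f x) * of_real (\<psi> x))"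
  proof (rule Bochner_Integration.integrable_bound)
    show "integrable lebesgue (\<lambda>x. of_real B * (indicator (cbox l h) x *\<^sub>R f x))"
      using i by (rule integrable_mult_right)
    show "(\<lambda>x. (indicator (cbox l h) x *\<^sub>R f x) * of_real (\<psi> x)) \<in> borel_measurable lebesgue"
      using i m by measurable
    show "AE x in lebesgue. norm ((indicator (cbox l h) x *\<^sub>R f x) * of_real (\<psi> x))
        \<le> norm (of_real B * (indicator (cbox l h) x *\<^sub>R f x))"
    proof (intro AE_I2)
      fix x show "norm ((indicator (cbox l h) x *\<^sub>R f x) * of_real (\<psi> x))
        \<le> norm (of_real B * (indicator (cbox l h) x *\<^sub>R f x))"
        using B[of x] by (auto simp: indicator_def norm_mult mult.commute intro!: mult_mono)
    qed
  qed
  moreover have "(indicator (cbox l h) x *\<^sub>R f x) * of_real (\<psi> x) = f x * of_real (\<psi> x)" for x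
    using assms(3) by (auto simp: indicator_def)
  ultimately show ?thesis by simp
qed

section \<open>The fundamental lemma of the calculus of variations\<close>

text \<open>The limit is the open interval, since a plateau vanishes at both ends for every width.
  This is why open boxes appear below.\<close>

lemma plateau_LIMSEQ: "(\<lambda>m. plateau (1 / Suc m) a b t) \<longlonglongrightarrow> indicator {a<..<b} t"
proof (cases "t \<in> {a<..<b}")
  case True
  then have "min (t - a) (b - t) > 0" by auto
  then obtain N where N: "1 / Suc N < min (t - a) (b - t)"
    using reals_Archimedean[of "min (t - a) (b - t)"] by (metis inverse_eq_divide)
  have "plateau (1 / Suc m) a b t = 1" if "m \<ge> N" for m
  proof -
    have "1 / Suc m \<le> 1 / Suc N" using that by (intro divide_left_mono) auto
    with N have "t \<in> {a + 1 / Suc m..b - 1 / Suc m}" by auto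
    then show ?thesis by (intro plateau_eq_1) auto
  qed
  then have "\<forall>\<^sub>F m in sequentially. 1 = plateau (1 / Suc m) a b t"
    unfolding eventually_sequentially by (intro exI[of _ N]) auto
  with True show ?thesis by (auto intro: Lim_transform_eventually[OF tendsto_const])
next
  case False
  then show ?thesis by (subst plateau_eq_0) auto
qed

text \<open>Products of ever steeper plateaus converge pointwise to the indicator of the open box,
  dominated by the indicator of the closed box; dominated convergence passes to the limit.\<close>

lemma integral_box_eq_0_if_tests_vanish:
  fixes R :: "real^'n::finite \<Rightarrow> complex"
  assumes R: "locint R" and "cbox l h \<subseteq> U"
    and tests: "\<And>b. (\<And>i. smooth1 (b i)) \<Longrightarrow> test_fun_on U (tensor b)
                  \<Longrightarrow> (LINT x|lebesgue. R x * of_real (tensor b x)) = 0"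
  shows "(LINT x:box l h|lebesgue. R x) = 0"
proof -
  define \<psi> where "\<psi> m = tensor (\<lambda>i. plateau (1 / Suc m) (l $ i) (h $ i))" for m
  have outside: "\<psi> m x = 0" if "x \<notin> cbox l h" for m x
    unfolding \<psi>_def by (rule tensor_eq_0[OF _ that]) (auto intro!: plateau_eq_0)
  have "0 \<le> \<psi> m x" "\<psi> m x \<le> 1" for m x
    unfolding \<psi>_def tensor_def by (auto intro!: prod_nonneg prod_le_1 simp: plateau_bounds)
  then have bound: "\<bar>\<psi> m x\<bar> \<le> 1" for m x by (simp add: abs_le_iff order_trans[of _ 0])
  have "(LINT x|lebesgue. R x * of_real (\<psi> m x)) = 0" for m
    unfolding \<psi>_def
  proof (intro tests smooth1_plateau test_fun_on_tensor)
    show "t \<notin> {l $ i..h $ i} \<Longrightarrow> plateau (1 / Suc m) (l $ i) (h $ i) t = 0" for i t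
      by (intro plateau_eq_0) auto
  qed fact
  moreover have "(\<lambda>m. LINT x|lebesgue. R x * of_real (\<psi> m x)) \<longlonglongrightarrow> (LINT x|lebesgue. indicator (box l h) x *\<^sub>R R x)"
  proof (rule integral_dominated_convergence)
    show "integrable lebesgue (\<lambda>x. norm (indicator (cbox l h) x *\<^sub>R R x))"
      using R by (simp add: locint_def set_integrable_def del: norm_scaleR)
    show "(\<lambda>x. indicator (box l h) x *\<^sub>R R x) \<in> borel_measurable lebesgue"
    proof -
      have "set_integrable lebesgue (box l h) R"
        by (rule set_integrable_subset[of _ "cbox l h"])
          (use R in \<open>auto simp: locint_def box_subset_cbox\<close>)
      then show ?thesis unfolding set_integrable_def by (rule borel_measurable_integrable)
    qed
    show "(\<lambda>x. R x * of_real (\<psi> m x)) \<in> borel_measurable lebesgue" for m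
      by (rule borel_measurable_integrable, rule locint_mult_continuous[OF R _ outside])
        (auto simp: \<psi>_def intro!: continuous_on_tensor smooth1_plateau)
    show "AE x in lebesgue. norm (R x * of_real (\<psi> m x)) \<le> norm (indicator (cbox l h) x *\<^sub>R R x)" for m
    proof (intro AE_I2)
      fix x show "norm (R x * of_real (\<psi> m x)) \<le> norm (indicator (cbox l h) x *\<^sub>R R x)"
        using bound[of m x] outside[of x m]
        by (cases "x \<in> cbox l h") (auto simp: norm_mult mult_left_le)
    qed
    have "(\<lambda>m. \<psi> m x) \<longlonglongrightarrow> (\<Prod>i\<in>UNIV. indicator {l $ i<..<h $ i} (x $ i))" for x
      unfolding \<psi>_def tensor_def by (intro tendsto_prod plateau_LIMSEQ)
    moreover have "(\<Prod>i\<in>UNIV. indicator {l $ i<..<h $ i} (x $ i)) = (indicator (box l h) x :: real)" for x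
      by (auto simp: indicator_def mem_box_cart)
    ultimately have lim: "(\<lambda>m. \<psi> m x) \<longlonglongrightarrow> indicator (box l h) x" for x by simp
    have "(\<lambda>m. R x * of_real (\<psi> m x)) \<longlonglongrightarrow> R x * of_real (indicator (box l h) x)" for x
      by (intro tendsto_intros lim)
    then show "AE x in lebesgue. (\<lambda>m. R x * of_real (\<psi> m x)) \<longlonglongrightarrow> indicator (box l h) x *\<^sub>R R x"
      by (simp add: scaleR_conv_of_real mult.commute)
  qed
  ultimately show ?thesis
    by (simp add: set_lebesgue_integral_def LIMSEQ_const_iff)
qed

section \<open>From vanishing integrals to vanishing almost everywhere\<close>

lemma sigma_finite_lebesgue: "sigma_finite_measure (lebesgue :: 'a::euclidean_space measure)"
proof
  show "\<exists>A::'a set set. countable A \<and> A \<subseteq> sets lebesgue \<and> \<Union>A = space lebesgue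
      \<and> (\<forall>a\<in>A. emeasure lebesgue a \<noteq> \<infinity>)"
    by (intro exI[of _ "range (\<lambda>n::nat. box (- real n *\<^sub>R One) (real n *\<^sub>R One))"])
      (auto simp: emeasure_lborel_box_eq UN_box_eq_UNIV)
qed

text \<open>Open boxes are an intersection-stable generator of the Borel sets, so a Dynkin argument
  carries vanishing integrals to all Borel sets; \<open>total\<close> serves the complement
  step.\<close>

lemma AE_zero_if_box_integrals_zero:
  fixes f :: "real^'n::finite \<Rightarrow> complex"
  assumes f: "integrable lebesgue f" and box: "\<And>a b. (LINT x:box a b|lebesgue. f x) = 0"
    and total: "(LINT x|lebesgue. f x) = 0"
  shows "AE x in lebesgue. f x = 0"
proof (rule sigma_finite_measure.density_zero[OF _ f])
  show "sigma_finite_measure (lebesgue :: (real^'n) measure)"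
    by (rule sigma_finite_lebesgue)
  have si: "set_integrable lebesgue A f" if "A \<in> sets lebesgue" for A
    using f that unfolding set_integrable_def by (simp add: integrable_mult_indicator)
  have borel: "(LINT x:A|lebesgue. f x) = 0" if "A \<in> sets borel" for A
  proof -
    have "Int_stable (range (\<lambda>(a, b). box a b :: (real^'n) set))"
      by (auto simp: Int_stable_def box_Int_box)
    moreover have "range (\<lambda>(a, b). box a b) \<subseteq> Pow (UNIV :: (real^'n) set)" by auto
    moreover have "A \<in> sigma_sets UNIV (range (\<lambda>(a, b). box a b))"
      using that unfolding borel_eq_box by simp
    ultimately show ?thesis
    proof (induction rule: sigma_sets_induct_disjoint)
      case (basic A)
      then show ?case using box by auto
    next
      case empty
      then show ?case by (simp add: set_lebesgue_integral_def)
    next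
      case (compl A)
      then have A: "A \<in> sets lebesgue" by (simp add: borel_eq_box)
      have "(LINT x:A \<union> (UNIV - A)|lebesgue. f x)
          = (LINT x:A|lebesgue. f x) + (LINT x:UNIV - A|lebesgue. f x)"
        using A by (intro set_integral_Un si) auto
      with compl.IH total show ?case by (simp add: set_lebesgue_integral_def)
    next
      case (union F)
      have F: "F i \<in> sets lebesgue" for i
      proof -
        have "F i \<in> sets borel" using union(2) by (simp add: borel_eq_box subset_eq)
        then show ?thesis by simp
      qed
      have "(LINT x:(\<Union>i. F i)|lebesgue. f x) = (\<Sum>i. (LINT x:F i|lebesgue. f x))"
        using union(1) F
        by (intro lebesgue_integral_countable_add si sets.countable_UN) (auto simp: disjoint_family_on_def)
      with union.IH show ?case by simp
    qed
  qed
  \<comment> \<open>A Lebesgue set is a Borel set up to a subset of a null set, which the integral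
    does not see.\<close>
  fix A :: "(real^'n) set" assume "A \<in> sets lebesgue"
  then obtain S N N' where A: "A = S \<union> N" "N \<subseteq> N'" "N' \<in> null_sets lborel" "S \<in> sets lborel"
    by (rule sets_completionE)
  have "AE x in lebesgue. x \<notin> N'"
    using A(3) by (intro AE_not_in null_sets_completionI)
  then have ae: "AE x in lebesgue. indicator A x *\<^sub>R f x = indicator S x *\<^sub>R f x"
    by eventually_elim (use A in \<open>auto simp: indicator_def\<close>)
  have "(LINT x:A|lebesgue. f x) = (LINT x:S|lebesgue. f x)"
    unfolding set_lebesgue_integral_def
  proof (rule integral_cong_AE[OF _ _ ae])
    show "(\<lambda>x. indicator A x *\<^sub>R f x) \<in> borel_measurable lebesgue"
      using si[OF \<open>A \<in> sets lebesgue\<close>] unfolding set_integrable_def by (rule borel_measurable_integrable)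
    show "(\<lambda>x. indicator S x *\<^sub>R f x) \<in> borel_measurable lebesgue"
      using si[of S] A(4) unfolding set_integrable_def by (auto intro: borel_measurable_integrable)
  qed
  with borel[of S] A(4) show "(LINT x:A|lebesgue. f x) = 0" by simp
qed

text \<open>Cutting \<open>R\<close> off to one box inside \<open>U\<close> makes it globally
  integrable with vanishing box integrals. Countably many closed boxes then exhaust
  \<open>U\<close>.\<close>

lemma fundamental_lemma:
  fixes R :: "real^'n::finite \<Rightarrow> complex"
  assumes R: "locint R" and "open U"
    and tests: "\<And>b. (\<And>i. smooth1 (b i)) \<Longrightarrow> test_fun_on U (tensor b)
                  \<Longrightarrow> (LINT x|lebesgue. R x * of_real (tensor b x)) = 0"
  shows "AE x in lebesgue. x \<in> U \<longrightarrow> R x = 0"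
proof -
  have cb: "AE x in lebesgue. x \<in> cbox c d \<longrightarrow> R x = 0" if cd: "cbox c d \<subseteq> U" for c d
  proof -
    let ?f = "\<lambda>x. indicator (box c d) x *\<^sub>R R x"
    have bz: "(LINT x:box a b|lebesgue. R x) = 0" if "cbox a b \<subseteq> cbox c d" for a b
      using integral_box_eq_0_if_tests_vanish[OF R _ tests] that cd by blast
    have "AE x in lebesgue. ?f x = 0"
    proof (rule AE_zero_if_box_integrals_zero)
      have "set_integrable lebesgue (box c d) R"
        by (rule set_integrable_subset[of _ "cbox c d"])
          (use R in \<open>auto simp: locint_def box_subset_cbox\<close>)
      then show "integrable lebesgue ?f" by (simp add: set_integrable_def)
      show "(LINT x|lebesgue. ?f x) = 0"
        using bz[of c d] by (simp add: set_lebesgue_integral_def)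
      fix a b :: "real^'n"
      \<comment> \<open>The corners of the intersection of the two boxes, which is again a
        box.\<close>
      let ?l = "\<Sum>i\<in>Basis. max (a\<bullet>i) (c\<bullet>i) *\<^sub>R i" and ?h = "\<Sum>i\<in>Basis. min (b\<bullet>i) (d\<bullet>i) *\<^sub>R i"
      have "(LINT x:box a b|lebesgue. ?f x) = (LINT x:box ?l ?h|lebesgue. R x)"
        unfolding box_Int_box[symmetric] set_lebesgue_integral_def
        by (rule Bochner_Integration.integral_cong) (auto simp: indicator_def)
      also have "\<dots> = 0"
        by (rule bz) (auto simp: mem_box)
      finally show "(LINT x:box a b|lebesgue. ?f x) = 0" .
    qed
    \<comment> \<open>The cut-off used the open box, whereas the covering is by closed ones; the
      difference is a null set.\<close>
    moreover have "AE x in lebesgue. x \<notin> cbox c d - box c d"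
      using negligible_frontier_interval[of c d] by (intro AE_not_in) (simp add: negligible_iff_null_sets)
    ultimately show ?thesis
      by eventually_elim (auto simp: indicator_def)
  qed
  obtain \<D> where D: "countable \<D>" "\<D> \<subseteq> Pow U" "\<And>X. X \<in> \<D> \<Longrightarrow> \<exists>a b. X = cbox a b" "\<Union>\<D> = U"
    using open_countable_Union_open_cbox[OF \<open>open U\<close>] by metis
  have "AE x in lebesgue. \<forall>X\<in>\<D>. x \<in> X \<longrightarrow> R x = 0"
    unfolding AE_ball_countable[OF D(1)]
  proof
    fix X assume X: "X \<in> \<D>"
    then obtain a b where "X = cbox a b" using D(3) by blast
    with X D(2) cb show "AE x in lebesgue. x \<in> X \<longrightarrow> R x = 0" by auto
  qed
  then show ?thesis
    by eventually_elim (use D(4) in blast)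
qed

text \<open>
  Locally, the boundary is the image of a hyperplane under the Lipschitz map \<open>x \<mapsto> x + g x \<cdot> \<nu>\<close>.
\<close>
lemma negligible_frontier_lipschitz_domain:
  fixes \<Omega> :: "(real^'n::finite) set"
  assumes "lipschitz_domain \<Omega>"
  shows "negligible (frontier \<Omega>)"
proof (subst locally_negligible_alt, rule ballI)
  fix p assume p: "p \<in> frontier \<Omega>"
  have "open \<Omega>" using assms by (simp add: lipschitz_domain_def)
  obtain r \<nu> g L where r: "r > 0" and \<nu>: "norm \<nu> = 1" and g: "L-lipschitz_on UNIV g"
    and g_const: "\<And>x t. g (x + t *\<^sub>R \<nu>) = g x"
    and graph: "\<Omega> \<inter> ball p r = {x \<in> ball p r. x \<bullet> \<nu> < g x}"
    using assms p unfolding lipschitz_domain_def by meson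
  have graph_iff: "x \<in> \<Omega> \<longleftrightarrow> x \<bullet> \<nu> < g x" if "x \<in> ball p r" for x
    using graph that by blast
  have cg: "continuous_on UNIV g" using g by (rule lipschitz_on_continuous_on)
  let ?h = "\<lambda>x. x + g x *\<^sub>R \<nu>"
  have neg: "negligible (?h ` {x. \<nu> \<bullet> x = 0})"
  proof (rule negligible_locally_Lipschitz_image)
    show "negligible {x. \<nu> \<bullet> x = 0}" by (rule negligible_hyperplane) (use \<nu> in auto)
    fix x
    have "norm (?h y - ?h x) \<le> (1 + L) * norm (y - x)" for y
    proof -
      have "norm (?h y - ?h x) = norm ((y - x) + (g y - g x) *\<^sub>R \<nu>)"
        by (simp add: algebra_simps)
      also have "\<dots> \<le> norm (y - x) + \<bar>g y - g x\<bar>"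
        using norm_triangle_ineq[of "y - x" "(g y - g x) *\<^sub>R \<nu>"] \<nu> by simp
      also have "\<bar>g y - g x\<bar> \<le> L * norm (y - x)"
        using lipschitz_onD[OF g, of y x] by (simp add: dist_norm)
      finally show ?thesis by (simp add: algebra_simps)
    qed
    then show "\<exists>T B. open T \<and> x \<in> T \<and> (\<forall>y\<in>{x. \<nu> \<bullet> x = 0} \<inter> T. norm (?h y - ?h x) \<le> B * norm (y - x))"
      by (intro exI[of _ UNIV] exI[of _ "1 + L"]) auto
  qed simp
  have "frontier \<Omega> \<inter> ball p r \<subseteq> ?h ` {x. \<nu> \<bullet> x = 0}"
  proof
    fix q assume q: "q \<in> frontier \<Omega> \<inter> ball p r"
    have "q \<bullet> \<nu> \<ge> g q"
    proof -
      have "q \<notin> \<Omega>" using q \<open>open \<Omega>\<close> by (simp add: frontier_def interior_open)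
      moreover have "q \<in> ball p r" using q by blast
      ultimately show ?thesis using graph_iff by (meson not_less)
    qed
    moreover have "q \<bullet> \<nu> \<le> g q"
    \<comment> \<open>Strictly above the graph lies an open set which, within the ball, misses
      \<open>\<Omega>\<close>; a point of the closure of \<open>\<Omega>\<close> cannot be in
      it.\<close>
    proof (rule ccontr)
      assume "\<not> q \<bullet> \<nu> \<le> g q"
      then have "q \<in> {x. g x < x \<bullet> \<nu>} \<inter> ball p r" using q by simp
      moreover have "open ({x. g x < x \<bullet> \<nu>} \<inter> ball p r)"
        by (intro open_Int open_Collect_less cg continuous_intros) auto
      moreover have "q \<in> closure \<Omega>" using q by (simp add: frontier_def)
      ultimately have "({x. g x < x \<bullet> \<nu>} \<inter> ball p r) \<inter> \<Omega> \<noteq> {}"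
        using open_Int_closure_eq_empty[of "{x. g x < x \<bullet> \<nu>} \<inter> ball p r" \<Omega>] by blast
      then obtain z where "z \<in> ball p r" "z \<in> \<Omega>" "g z < z \<bullet> \<nu>" by blast
      with graph_iff show False by (meson less_asym)
    qed
    ultimately have eq: "q \<bullet> \<nu> = g q" by simp
    have "\<nu> \<bullet> \<nu> = 1" using \<nu> by (simp add: norm_eq_1)
    then have "q - (q \<bullet> \<nu>) *\<^sub>R \<nu> \<in> {x. \<nu> \<bullet> x = 0}"
      by (simp add: inner_diff_right inner_commute)
    \<comment> \<open>Since \<open>g\<close> is constant along \<open>\<nu>\<close>, projecting
      \<open>q\<close> to the hyperplane does not change its value, and \<open>?h\<close> restores
      the lost component.\<close>
    moreover have "q = ?h (q - (q \<bullet> \<nu>) *\<^sub>R \<nu>)"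
      using g_const[of q "- (q \<bullet> \<nu>)"] eq by simp
    ultimately show "q \<in> ?h ` {x. \<nu> \<bullet> x = 0}" by blast
  qed
  with neg have "negligible (frontier \<Omega> \<inter> ball p r)" by (rule negligible_subset)
  then show "\<exists>U. openin (top_of_set (frontier \<Omega>)) U \<and> p \<in> U \<and> negligible U"
    using p r by (intro exI[of _ "frontier \<Omega> \<inter> ball p r"]) (auto simp: openin_open_Int)
qed

section \<open>Orthogonality of \<open>V u\<close> to a Helmholtz solution\<close>

lemma partial_cong_open:
  assumes "open W" "\<And>y. y \<in> W \<Longrightarrow> f y = g y" "x \<in> W"
  shows "partial i f x = partial i g x"
proof -
  have "isCont (\<lambda>t. x + t *\<^sub>R axis i (1::real)) 0" by (intro continuous_intros)
  then have "((\<lambda>t. x + t *\<^sub>R axis i (1::real)) \<longlongrightarrow> x + 0 *\<^sub>R axis i 1) (nhds 0)"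
    using tendsto_at_iff_tendsto_nhds[of "\<lambda>t. x + t *\<^sub>R axis i (1::real)" 0] by (simp only: isCont_def)
  then have "((\<lambda>t. x + t *\<^sub>R axis i (1::real)) \<longlongrightarrow> x) (nhds 0)" by simp
  then have "\<forall>\<^sub>F t in nhds 0. x + t *\<^sub>R axis i (1::real) \<in> W"
    using assms(1,3) topological_tendstoD by blast
  then have "\<forall>\<^sub>F t in nhds 0. f (x + t *\<^sub>R axis i 1) = g (x + t *\<^sub>R axis i 1)"
    by eventually_elim (use assms(2) in blast)
  then show ?thesis unfolding partial_def by (rule deriv_cong_ev) simp
qed

lemma partial_partial_cong_open:
  assumes "open W" "\<And>y. y \<in> W \<Longrightarrow> f y = g y" "x \<in> W"
  shows "partial i (partial j f) x = partial i (partial j g) x"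
  using assms by (intro partial_cong_open[of W]) auto

lemma laplacian_cong_open:
  assumes "open W" "\<And>y. y \<in> W \<Longrightarrow> f y = g y" "x \<in> W"
  shows "laplacian f x = laplacian g x"
  unfolding laplacian_def using assms by (intro sum.cong refl partial_partial_cong_open[of W])

lemma partial_zero: "partial i (\<lambda>x. 0) = (\<lambda>x. 0)"
  by (simp add: partial_def fun_eq_iff)

lemma eq_0_outside_fsupport: "x \<notin> fsupport f \<Longrightarrow> f x = 0"
  unfolding fsupport_def using closure_subset[of "{x. f x \<noteq> 0}"] by blast

lemma partial_partial_outside_fsupport:
  assumes "x \<notin> fsupport f"
  shows "partial i (partial j f) x = 0"
proof -
  have "partial i (partial j f) x = partial i (partial j (\<lambda>x. 0)) x"
    by (rule partial_partial_cong_open[of "- fsupport f"])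
      (use assms eq_0_outside_fsupport in \<open>auto simp: fsupport_def\<close>)
  then show ?thesis by (simp add: partial_zero)
qed

lemma laplacian_outside_fsupport: "x \<notin> fsupport f \<Longrightarrow> laplacian f x = 0"
  by (simp add: laplacian_def partial_partial_outside_fsupport)

text \<open>All three multipliers are continuous and vanish outside a box around the compact
  support.\<close>

lemma test_tensor_integrable:
  fixes b :: "'n::finite \<Rightarrow> real \<Rightarrow> real"
  assumes "locint f" and b: "\<And>i. smooth1 (b i)" and "test_fun_on S (tensor b)"
  shows "integrable lebesgue (\<lambda>x. f x * of_real (tensor b x))"
    and "integrable lebesgue (\<lambda>x. f x * of_real (partial i (partial i (tensor b)) x))"
    and "integrable lebesgue (\<lambda>x. f x * of_real (laplacian (tensor b) x))"
proof -
  have "bounded (fsupport (tensor b))"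
    using assms(3) compact_imp_bounded unfolding test_fun_on_def by blast
  then obtain a where a: "fsupport (tensor b) \<subseteq> cbox (- a) a"
    using bounded_subset_cbox_symmetric by blast
  have cont: "continuous_on UNIV (partial i (partial i (tensor b)))" for i
    using b by (simp add: partial_tensor smooth1_deriv continuous_on_tensor)
  show "integrable lebesgue (\<lambda>x. f x * of_real (tensor b x))"
    by (rule locint_mult_continuous[of f _ "-a" a])
      (use assms a eq_0_outside_fsupport[of _ "tensor b"] in \<open>auto intro: continuous_on_tensor\<close>)
  show "integrable lebesgue (\<lambda>x. f x * of_real (partial i (partial i (tensor b)) x))"
    by (rule locint_mult_continuous[of f _ "-a" a])
      (use assms a cont in \<open>auto intro!: partial_partial_outside_fsupport\<close>)
  have "continuous_on UNIV (laplacian (tensor b))"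
    unfolding laplacian_def[abs_def] by (intro continuous_on_sum cont)
  then show "integrable lebesgue (\<lambda>x. f x * of_real (laplacian (tensor b) x))"
    by (rule locint_mult_continuous[of f _ "-a" a, rotated])
      (use assms a in \<open>auto intro!: laplacian_outside_fsupport\<close>)
qed

lemma locint_continuous:
  fixes f :: "real^'n::finite \<Rightarrow> complex"
  assumes "continuous_on (closure S) f" "bounded S" "S \<in> sets lebesgue"
  shows "integrable lebesgue (\<lambda>x. indicator S x *\<^sub>R f x)"
    and "locint (\<lambda>x. indicator S x *\<^sub>R f x)"
proof -
  have "set_integrable lborel (closure S) f"
    using assms borel_integrable_compact[of "closure S" f]
    by (simp add: set_integrable_def indicator_scaleR_eq_if)
  then have "set_integrable lebesgue (closure S) f"
    by (simp add: set_integrable_def integrable_completion)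
  then show *: "integrable lebesgue (\<lambda>x. indicator S x *\<^sub>R f x)"
    using set_integrable_subset[of lebesgue "closure S" f S] assms(3) closure_subset
    unfolding set_integrable_def by blast
  show "locint (\<lambda>x. indicator S x *\<^sub>R f x)"
    unfolding locint_def set_integrable_def using *
    by (intro allI integrable_mult_indicator[where f = "\<lambda>x. indicator S x *\<^sub>R f x"]) auto
qed

text \<open>The cosine is itself a product with all other factors 1, and solves the Helmholtz
  equation on the whole space. Multiplying each factor by a plateau gives compact support and
  changes nothing on a ball around \<open>S\<close>.\<close>

lemma tensor_plateau_cos:
  fixes i0 :: "'n::finite" and k c :: real and S :: "(real^'n) set"
  assumes "bounded S"
  obtains b W where "\<And>i. smooth1 (b i)" "test_fun_on UNIV (tensor b)"
    "open W" "S \<subseteq> W" "\<And>x. x \<in> W \<Longrightarrow> tensor b x = cos (k * (x $ i0 - c))"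
    "\<And>x. x \<in> W \<Longrightarrow> laplacian (tensor b) x = - k\<^sup>2 * tensor b x"
proof -
  obtain M where M: "\<And>x. x \<in> S \<Longrightarrow> norm x < M" "M > 0"
    using assms bounded_pos_less by blast
  define e where "e i = (if i = i0 then (\<lambda>t. cos (k * t + (- k * c))) else (\<lambda>t. 1))" for i
  define b where "b i = (\<lambda>t. plateau 1 (- M - 1) (M + 1) t * e i t)" for i
  have e_smooth: "smooth1 (e i)" for i
    using smooth1_affine[OF smooth1_cos, of k "- k * c"]
    by (auto simp: e_def smooth1_def diffn_const)
  have b_smooth: "smooth1 (b i)" for i
    unfolding b_def by (intro smooth1_mult smooth1_plateau e_smooth)
  have e_tensor: "tensor e x = cos (k * (x $ i0 - c))" for x
    by (subst tensor_split[of _ _ i0]) (simp add: e_def algebra_simps)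
  have eq: "tensor b x = tensor e x" if "x \<in> ball 0 M" for x
  proof -
    have "b i (x $ i) = e i (x $ i)" for i
    proof -
      have "\<bar>x $ i\<bar> < M" using component_le_norm_cart[of x i] that by simp
      then show ?thesis unfolding b_def by (subst plateau_eq_1) auto
    qed
    then show ?thesis by (simp add: tensor_def)
  qed
  have "deriv (e i0) = (\<lambda>t. - k * sin (k * t + (- k * c)))"
    by (rule ext, rule DERIV_imp_deriv) (auto simp: e_def intro!: derivative_eq_intros)
  then have e2: "deriv (deriv (e i0)) = (\<lambda>t. - k\<^sup>2 * e i0 t)"
    by (intro ext DERIV_imp_deriv) (auto simp: e_def power2_eq_square intro!: derivative_eq_intros)
  have e_lap: "laplacian (tensor e) x = - k\<^sup>2 * tensor e x" for x
  proof -
    have *: "tensor (e(i := deriv (deriv (e i)))) x = (if i = i0 then - k\<^sup>2 * tensor e x else 0)" for i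
    proof (cases "i = i0")
      case True
      then show ?thesis
        by (simp add: tensor_split[of _ x i0] e2)
    next
      case False
      then have "deriv (deriv (e i)) = (\<lambda>t. 0)" by (simp add: e_def deriv_const)
      with False show ?thesis by (simp add: tensor_split[of _ x i])
    qed
    show ?thesis unfolding laplacian_tensor[of e, OF e_smooth] * by simp
  qed
  show thesis
  proof
    show "test_fun_on UNIV (tensor b)"
    proof (rule test_fun_on_tensor[OF b_smooth])
      show "t \<notin> {(\<chi> i. - M - 1) $ i..(\<chi> i. M + 1) $ i} \<Longrightarrow> b i t = 0" for i t
        unfolding b_def by (subst plateau_eq_0) auto
    qed simp
    show "S \<subseteq> ball 0 M" using M by auto
    fix x :: "real^'n" assume x: "x \<in> ball 0 M"
    show "tensor b x = cos (k * (x $ i0 - c))" using eq[OF x] e_tensor by simp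
    \<comment> \<open>The two products agree on an open set, so their derivatives agree there
      too.\<close>
    have "laplacian (tensor b) x = laplacian (tensor e) x"
      by (rule laplacian_cong_open[of "ball 0 M"]) (use x eq in auto)
    then show "laplacian (tensor b) x = - k\<^sup>2 * tensor b x" using eq[OF x] e_lap by simp
  qed (auto simp: b_smooth)
qed

text \<open>The extension of \<open>u - w\<close> by zero solves an inhomogeneous Helmholtz equation
  with source supported in \<open>\<Omega>\<close>. Pairing it with a homogeneous solution leaves
  only the source term.\<close>

lemma transmission_orthogonality:
  fixes \<Omega> :: "(real^'n::finite) set" and u w V :: "real^'n \<Rightarrow> complex"
  assumes "open \<Omega>" "bounded \<Omega>" "negligible (frontier \<Omega>)"
    and te: "transmission_eigenfunctions \<Omega> V k u w"
    and cont: "continuous_on (closure \<Omega>) V" "continuous_on (closure \<Omega>) u"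
  shows "(LINT x:\<Omega>|lebesgue. V x * u x * of_real (cos (k * (x $ i0 - c)))) = 0"
proof -
  have L2: "L2_on \<Omega> u" "L2_on \<Omega> w" and weak: "weak_helmholtz \<Omega> k (\<lambda>x. 1) w" "weak_helmholtz \<Omega> k (\<lambda>x. 1 + V x) u"
    and "H2_0 \<Omega> (\<lambda>x. u x - w x)" "k > 0"
    using te by (auto simp: transmission_eigenfunctions_def)
  then obtain F where F: "H2 F" and F_out: "AE x in lebesgue. x \<notin> closure \<Omega> \<longrightarrow> F x = 0"
    and F_in: "AE x in lebesgue. x \<in> \<Omega> \<longrightarrow> F x = u x - w x"
    by (auto simp: H2_0_def)
  have "\<forall>i. \<exists>G. L2_on UNIV G \<and> (\<forall>\<phi>. test_fun_on UNIV \<phi> \<longrightarrow>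
           (LINT x|lebesgue. F x * of_real (partial i (partial i \<phi>) x)) = (LINT x|lebesgue. G x * of_real (\<phi> x)))"
    using F unfolding H2_def by blast
  then obtain G where G_L2: "\<And>i. L2_on UNIV (G i)" and G: "\<And>i \<phi>. test_fun_on UNIV \<phi> \<Longrightarrow>
           (LINT x|lebesgue. F x * of_real (partial i (partial i \<phi>) x)) = (LINT x|lebesgue. G i x * of_real (\<phi> x))"
    by metis
  define U where "U x = indicator \<Omega> x *\<^sub>R u x" for x
  define Wf where "Wf x = indicator \<Omega> x *\<^sub>R w x" for x
  define Q where "Q x = indicator \<Omega> x *\<^sub>R (V x * u x)" for x
  define K where "K = (of_real k :: complex)\<^sup>2"
  \<comment> \<open>The residual of the equation for \<open>F\<close>, with the weak second
    derivatives \<open>G i\<close> summing to its Laplacian. The aim is that it vanishes almost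
    everywhere.\<close>
  define R where "R x = (\<Sum>i\<in>UNIV. G i x) + (K * F x + K * Q x)" for x
  have li_U: "locint U" and li_W: "locint Wf"
    using L2_on_imp_locint L2 by (auto simp: U_def[abs_def] Wf_def[abs_def])
  have li_F: "locint F" and li_G: "locint (G i)" for i
    using L2_on_imp_locint[of UNIV F] L2_on_imp_locint[OF G_L2[of i]] F by (auto simp: H2_def)
  have "\<Omega> \<in> sets lebesgue" using \<open>open \<Omega>\<close> by auto
  then have li_Q: "locint Q"
    unfolding Q_def using assms(2) by (intro locint_continuous continuous_intros cont)
  have li_R: "locint R"
    unfolding R_def by (intro locint_add locint_sum locint_mult li_F li_G li_Q)
  \<comment> \<open>Integration by parts in reverse: the defining property of \<open>G i\<close>
    moves both derivatives onto the test function.\<close>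
  have R_eq: "(LINT x|lebesgue. R x * of_real (tensor b x))
      = (LINT x|lebesgue. F x * of_real (laplacian (tensor b) x))
        + (K * (LINT x|lebesgue. F x * of_real (tensor b x)) + K * (LINT x|lebesgue. Q x * of_real (tensor b x)))"
    if b: "\<And>i. smooth1 (b i)" and t: "test_fun_on UNIV (tensor b)" for b
  proof -
    note int = test_tensor_integrable[OF _ b t]
    have "(LINT x|lebesgue. F x * of_real (laplacian (tensor b) x))
        = (LINT x|lebesgue. (\<Sum>i\<in>UNIV. F x * of_real (partial i (partial i (tensor b)) x)))"
      by (simp add: laplacian_def sum_distrib_left)
    also have "\<dots> = (\<Sum>i\<in>UNIV. (LINT x|lebesgue. F x * of_real (partial i (partial i (tensor b)) x)))"
      by (intro Bochner_Integration.integral_sum int(2) li_F)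
    also have "\<dots> = (\<Sum>i\<in>UNIV. (LINT x|lebesgue. G i x * of_real (tensor b x)))"
      by (simp add: G[OF t])
    also have "\<dots> = (LINT x|lebesgue. (\<Sum>i\<in>UNIV. G i x * of_real (tensor b x)))"
      by (intro Bochner_Integration.integral_sum[symmetric] int(1) li_G)
    finally have 1: "(LINT x|lebesgue. F x * of_real (laplacian (tensor b) x)) = \<dots>" .
    have "(LINT x|lebesgue. R x * of_real (tensor b x))
        = (LINT x|lebesgue. (\<Sum>i\<in>UNIV. G i x * of_real (tensor b x))
          + (K * (F x * of_real (tensor b x)) + K * (Q x * of_real (tensor b x))))"
      by (simp add: R_def algebra_simps sum_distrib_right sum_distrib_left)
    also have "\<dots> = (LINT x|lebesgue. (\<Sum>i\<in>UNIV. G i x * of_real (tensor b x)))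
          + ((LINT x|lebesgue. K * (F x * of_real (tensor b x))) + (LINT x|lebesgue. K * (Q x * of_real (tensor b x))))"
      by (subst Bochner_Integration.integral_add Bochner_Integration.integral_add;
          (intro Bochner_Integration.integrable_add integrable_mult_right
            Bochner_Integration.integrable_sum int(1) li_F li_G li_Q)?)+ (rule refl)
    finally show ?thesis unfolding 1 by simp
  qed
  have inside: "(LINT x|lebesgue. R x * of_real (tensor b x)) = 0"
    if b: "\<And>i. smooth1 (b i)" and t: "test_fun_on \<Omega> (tensor b)" for b
  proof -
    note int = test_tensor_integrable[OF _ b t]
    let ?\<phi> = "\<lambda>x. of_real (tensor b x) :: complex" and ?L = "\<lambda>x. of_real (laplacian (tensor b) x) :: complex"
    have t': "test_fun_on UNIV (tensor b)" using t by (simp add: test_fun_on_def)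
    have zero: "?\<phi> x = 0" "?L x = 0" if "x \<notin> \<Omega>" for x
      using that t eq_0_outside_fsupport[of x "tensor b"] laplacian_outside_fsupport[of x "tensor b"]
      by (auto simp: test_fun_on_def)
    have "0 = (LINT x:\<Omega>|lebesgue. u x * (?L x + (of_real k)\<^sup>2 * (1 + V x) * ?\<phi> x))"
      using weak(2) t unfolding weak_helmholtz_def by simp
    also have "\<dots> = (LINT x|lebesgue. U x * ?L x + (K * (U x * ?\<phi> x) + K * (Q x * ?\<phi> x)))"
      unfolding set_lebesgue_integral_def
      by (rule Bochner_Integration.integral_cong)
        (auto simp: U_def Q_def K_def indicator_def algebra_simps)
    also have "\<dots> = (LINT x|lebesgue. U x * ?L x)
        + (K * (LINT x|lebesgue. U x * ?\<phi> x) + K * (LINT x|lebesgue. Q x * ?\<phi> x))"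
      by (simp add: int li_U li_Q)
    finally have u_eq: "\<dots> = 0" by simp
    have "0 = (LINT x:\<Omega>|lebesgue. w x * (?L x + (of_real k)\<^sup>2 * 1 * ?\<phi> x))"
      using weak(1) t unfolding weak_helmholtz_def by simp
    also have "\<dots> = (LINT x|lebesgue. Wf x * ?L x + K * (Wf x * ?\<phi> x))"
      unfolding set_lebesgue_integral_def
      by (rule Bochner_Integration.integral_cong)
        (auto simp: Wf_def K_def indicator_def algebra_simps)
    also have "\<dots> = (LINT x|lebesgue. Wf x * ?L x) + K * (LINT x|lebesgue. Wf x * ?\<phi> x)"
      by (simp add: int li_W)
    finally have w_eq: "\<dots> = 0" by simp
    \<comment> \<open>The identity \<open>F\<close> = \<open>U\<close> - \<open>Wf\<close> is known
      almost everywhere on \<open>\<Omega>\<close> only, so the multiplier must vanish off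
      \<open>\<Omega>\<close>.\<close>
    have F_eq: "(LINT x|lebesgue. F x * f x) = (LINT x|lebesgue. U x * f x) - (LINT x|lebesgue. Wf x * f x)"
      if f: "\<And>x. x \<notin> \<Omega> \<Longrightarrow> f x = 0" and i: "integrable lebesgue (\<lambda>x. F x * f x)"
        "integrable lebesgue (\<lambda>x. U x * f x)" "integrable lebesgue (\<lambda>x. Wf x * f x)" for f
    proof -
      have "(LINT x|lebesgue. F x * f x) = (LINT x|lebesgue. U x * f x - Wf x * f x)"
      proof (rule integral_cong_AE)
        show "AE x in lebesgue. F x * f x = U x * f x - Wf x * f x"
          using F_in by eventually_elim (use f in \<open>auto simp: U_def Wf_def indicator_def left_diff_distrib\<close>)
      qed (use i in \<open>auto intro!: borel_measurable_integrable\<close>)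
      with i show ?thesis by simp
    qed
    have "(LINT x|lebesgue. F x * ?L x) = (LINT x|lebesgue. U x * ?L x) - (LINT x|lebesgue. Wf x * ?L x)"
      by (rule F_eq) (simp_all add: zero int li_F li_U li_W)
    moreover have "(LINT x|lebesgue. F x * ?\<phi> x) = (LINT x|lebesgue. U x * ?\<phi> x) - (LINT x|lebesgue. Wf x * ?\<phi> x)"
      by (rule F_eq) (simp_all add: zero int li_F li_U li_W)
    \<comment> \<open>Subtracting the weak equation for \<open>w\<close> from that for
      \<open>u\<close> is exactly the right-hand side of \<open>R_eq\<close>.\<close>
    ultimately show ?thesis
      unfolding R_eq[OF b t']
      using u_eq w_eq by algebra
  qed
  \<comment> \<open>Off the closure both \<open>F\<close> and \<open>Q\<close> vanish, so no term of
    \<open>R_eq\<close> survives.\<close>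
  have outside: "(LINT x|lebesgue. R x * of_real (tensor b x)) = 0"
    if b: "\<And>i. smooth1 (b i)" and t: "test_fun_on (- closure \<Omega>) (tensor b)" for b
  proof -
    have t': "test_fun_on UNIV (tensor b)" using t by (simp add: test_fun_on_def)
    have zero: "tensor b x = 0" "laplacian (tensor b) x = 0" if "x \<in> closure \<Omega>" for x
      using that t eq_0_outside_fsupport[of x "tensor b"] laplacian_outside_fsupport[of x "tensor b"]
      by (auto simp: test_fun_on_def)
    have "(LINT x|lebesgue. F x * of_real (laplacian (tensor b) x)) = 0"
      by (rule integral_eq_zero_AE) (use F_out in eventually_elim, use zero in auto)
    moreover have "(LINT x|lebesgue. F x * of_real (tensor b x)) = 0"
      by (rule integral_eq_zero_AE) (use F_out in eventually_elim, use zero in auto)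
    moreover have "(\<lambda>x. Q x * of_real (tensor b x)) = (\<lambda>x. 0)"
      using zero closure_subset by (fastforce simp: Q_def indicator_def)
    ultimately show ?thesis unfolding R_eq[OF b t'] by simp
  qed
  \<comment> \<open>Neither family of test functions sees the boundary, which has to be a null set
    for \<open>R\<close> to vanish on the whole space.\<close>
  have "AE x in lebesgue. x \<notin> frontier \<Omega>"
    using assms(3) by (intro AE_not_in) (simp add: negligible_iff_null_sets)
  moreover have "AE x in lebesgue. x \<in> \<Omega> \<longrightarrow> R x = 0"
    by (rule fundamental_lemma[OF li_R \<open>open \<Omega>\<close> inside])
  moreover have "AE x in lebesgue. x \<in> - closure \<Omega> \<longrightarrow> R x = 0"
    by (rule fundamental_lemma[OF li_R _ outside]) auto
  ultimately have R0: "AE x in lebesgue. R x = 0"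
    by eventually_elim (use \<open>open \<Omega>\<close> in \<open>auto simp: frontier_def interior_open\<close>)
  obtain b W where b: "\<And>i. smooth1 (b i)" and t: "test_fun_on UNIV (tensor b)"
    and W: "open W" "closure \<Omega> \<subseteq> W" and b_cos: "\<And>x. x \<in> W \<Longrightarrow> tensor b x = cos (k * (x $ i0 - c))"
    and b_lap: "\<And>x. x \<in> W \<Longrightarrow> laplacian (tensor b) x = - k\<^sup>2 * tensor b x"
    using tensor_plateau_cos[of "closure \<Omega>" k i0 c] assms(2) bounded_closure by metis
  note int = test_tensor_integrable[OF _ b t]
  have "0 = (LINT x|lebesgue. R x * of_real (tensor b x))"
    by (rule integral_eq_zero_AE[symmetric]) (use R0 in eventually_elim, simp)
  also have "\<dots> = (LINT x|lebesgue. F x * of_real (laplacian (tensor b) x) + K * (F x * of_real (tensor b x)))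
      + K * (LINT x|lebesgue. Q x * of_real (tensor b x))"
    unfolding R_eq[OF b t] by (simp add: int li_F)
  \<comment> \<open>The integrand is zero pointwise almost everywhere: off the closure because of
    \<open>F\<close>, on it because the Laplacian of the test function is -k^2 times the
    function.\<close>
  also have "(LINT x|lebesgue. F x * of_real (laplacian (tensor b) x) + K * (F x * of_real (tensor b x))) = 0"
  proof (rule integral_eq_zero_AE)
    show "AE x in lebesgue. F x * of_real (laplacian (tensor b) x) + K * (F x * of_real (tensor b x)) = 0"
      using F_out
    proof eventually_elim
      case (elim x)
      show ?case
      proof (cases "x \<in> closure \<Omega>")
        case True
        then have "x \<in> W" using W by blast
        then show ?thesis by (simp add: b_lap K_def)
      qed (use elim in simp)
    qed
  qed
  finally have "(LINT x|lebesgue. Q x * of_real (tensor b x)) = 0"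
    using \<open>k > 0\<close> by (simp add: K_def)
  moreover have "Q x * of_real (tensor b x) = indicator \<Omega> x *\<^sub>R (V x * u x * of_real (cos (k * (x $ i0 - c))))" for x
    using W closure_subset[of \<Omega>] b_cos[of x] by (auto simp: Q_def indicator_def)
  ultimately show ?thesis by (simp add: set_lebesgue_integral_def)
qed

section \<open>The boundary estimate\<close>

text \<open>Splits the norm into its supremum \<open>A\<close> and its seminorm \<open>B\<close>.
  Two distinct points make the set of difference quotients nonempty, so that its supremum is
  nonnegative.\<close>

lemma holder_normE:
  assumes "holder_on \<alpha> S f" "a \<in> S" "b \<in> S" "a \<noteq> b"
  obtains A B where "holder_norm \<alpha> S f = A + B" "0 \<le> A" "0 \<le> B"
    "\<And>x. x \<in> S \<Longrightarrow> cmod (f x) \<le> A"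
    "\<And>x y. x \<in> S \<Longrightarrow> y \<in> S \<Longrightarrow> cmod (f x - f y) \<le> B * dist x y powr \<alpha>"
proof -
  define P where "P = {(x, y). x \<in> S \<and> y \<in> S \<and> x \<noteq> y}"
  define q where "q = (\<lambda>p. cmod (f (fst p) - f (snd p)) / dist (fst p) (snd p) powr \<alpha>)"
  define A where "A = (SUP x\<in>S. cmod (f x))"
  define B where "B = (SUP p\<in>P. q p)"
  obtain c where "\<And>x y. x \<in> S \<Longrightarrow> y \<in> S \<Longrightarrow> cmod (f x - f y) \<le> c * dist x y powr \<alpha>"
    using assms(1) unfolding holder_on_def by blast
  then have "q p \<le> c" if "p \<in> P" for p
    using that unfolding P_def q_def by (auto simp: field_simps)
  then have bdd_q: "bdd_above (q ` P)" by (rule bdd_aboveI2)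
  have "bounded (f ` S)" using assms(1) by (simp add: holder_on_def)
  then obtain M where "\<And>x. x \<in> S \<Longrightarrow> cmod (f x) \<le> M"
    unfolding bounded_iff by blast
  then have bdd_f: "bdd_above ((\<lambda>x. cmod (f x)) ` S)" by (rule bdd_aboveI2)
  have A: "cmod (f x) \<le> A" if "x \<in> S" for x
    unfolding A_def using that bdd_f by (rule cSUP_upper)
  have B: "q p \<le> B" if "p \<in> P" for p
    unfolding B_def using that bdd_q by (rule cSUP_upper)
  show thesis
  proof
    show "holder_norm \<alpha> S f = A + B"
      by (simp add: holder_norm_def A_def B_def P_def q_def)
    show "0 \<le> A" using A[OF assms(2)] norm_ge_zero order_trans by blast
    have "0 \<le> q (a, b)" by (simp add: q_def)
    also have "\<dots> \<le> B" by (rule B) (use assms in \<open>simp add: P_def\<close>)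
    finally show "0 \<le> B" .
    show "cmod (f x - f y) \<le> B * dist x y powr \<alpha>" if "x \<in> S" "y \<in> S" for x y
    proof (cases "x = y")
      case False
      then have "q (x, y) \<le> B" using that by (intro B) (simp add: P_def)
      with False show ?thesis by (simp add: q_def field_simps)
    qed simp
  qed (rule A)
qed

lemma holder_on_imp_continuous_on:
  assumes "holder_on \<alpha> S f" "\<alpha> > 0"
  shows "continuous_on S f"
  unfolding continuous_on_def
proof
  fix x assume x: "x \<in> S"
  obtain c where c: "\<And>x y. x \<in> S \<Longrightarrow> y \<in> S \<Longrightarrow> cmod (f x - f y) \<le> c * dist x y powr \<alpha>"
    using assms(1) unfolding holder_on_def by blast
  have "((\<lambda>y. c * dist y x powr \<alpha>) \<longlongrightarrow> c * dist x x powr \<alpha>) (at x within S)"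
    using assms(2) by (intro tendsto_intros) (auto simp: eventually_at_filter)
  then have "((\<lambda>y. c * dist y x powr \<alpha>) \<longlongrightarrow> 0) (at x within S)" by simp
  then have "((\<lambda>y. f y - f x) \<longlongrightarrow> 0) (at x within S)"
  proof (rule Lim_null_comparison[rotated])
    show "\<forall>\<^sub>F y in at x within S. cmod (f y - f x) \<le> c * dist y x powr \<alpha>"
      using c x by (auto simp: eventually_at_filter)
  qed
  then show "(f \<longlongrightarrow> f x) (at x within S)" by (simp add: LIM_zero_iff)
qed

text \<open>Orthogonality gives z \<integral> c = \<integral> (z - g) c over
  \<open>\<Omega>\<close>. If m is the measure of \<open>\<Omega>\<close>, the left side has modulus
  at least |z| m/2, the right side at most m H.\<close>

lemma oscillation_bound:
  fixes g :: "real^'n::finite \<Rightarrow> complex" and c :: "real^'n \<Rightarrow> real"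
  assumes "open \<Omega>" "\<Omega> \<noteq> {}" "bounded \<Omega>" and g: "continuous_on (closure \<Omega>) g" and c: "continuous_on UNIV c"
    and orth: "(LINT x:\<Omega>|lebesgue. g x * of_real (c x)) = 0"
    and c_bounds: "\<And>x. x \<in> \<Omega> \<Longrightarrow> 1/2 \<le> c x" "\<And>x. x \<in> \<Omega> \<Longrightarrow> c x \<le> 1"
    and osc: "\<And>x. x \<in> \<Omega> \<Longrightarrow> cmod (z - g x) \<le> H"
  shows "cmod z \<le> 2 * H"
proof -
  have lm: "\<Omega> \<in> lmeasurable" using assms by (simp add: lmeasurable_open)
  then have ms: "\<Omega> \<in> sets lebesgue" by blast
  have cc: "continuous_on (closure \<Omega>) c" using c continuous_on_subset by blast
  have int_ind: "integrable lebesgue (\<lambda>x. indicator \<Omega> x :: real)"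
    using lm by (simp add: lmeasurable_iff_integrable)
  have int_gc: "integrable lebesgue (\<lambda>x. indicator \<Omega> x *\<^sub>R (g x * of_real (c x)))"
    by (intro locint_continuous(1) continuous_intros g cc assms ms)
  have int_cC: "integrable lebesgue (\<lambda>x. indicator \<Omega> x *\<^sub>R (of_real (c x) :: complex))"
    by (intro locint_continuous(1) continuous_intros cc assms ms)
  moreover have "indicator \<Omega> x *\<^sub>R (of_real (c x) :: complex) = of_real (indicator \<Omega> x * c x)" for x
    by (simp add: scaleR_conv_of_real)
  ultimately have int_c: "integrable lebesgue (\<lambda>x. indicator \<Omega> x * c x)"
    by (simp only: complex_of_real_integrable_eq)
  define m where "m = measure lebesgue \<Omega>"
  have "\<not> negligible \<Omega>" using assms by (simp add: open_not_negligible)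
  then have "m > 0" using negligible_iff_measure lm measure_nonneg unfolding m_def by (metis order_le_less)
  define J where "J = (LINT x|lebesgue. indicator \<Omega> x * c x)"
  have "m / 2 = (LINT x|lebesgue. indicator \<Omega> x * (1/2))"
    using lm by (simp add: m_def)
  also have "\<dots> \<le> J"
    unfolding J_def using c_bounds(1) int_ind int_c
    by (intro integral_mono) (auto simp: indicator_def)
  finally have J: "m / 2 \<le> J" .
  have "z * of_real J = z * (LINT x|lebesgue. of_real (indicator \<Omega> x * c x))"
    unfolding J_def by (simp only: integral_complex_of_real)
  also have "\<dots> = (LINT x|lebesgue. z * of_real (indicator \<Omega> x * c x))"
    by simp
  \<comment> \<open>The subtracted integral is zero by \<open>orth\<close>.\<close>
  also have "\<dots> = (LINT x|lebesgue. z * of_real (indicator \<Omega> x * c x)) - (LINT x|lebesgue. indicator \<Omega> x *\<^sub>R (g x * of_real (c x)))"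
    using orth by (simp add: set_lebesgue_integral_def)
  also have "\<dots> = (LINT x|lebesgue. z * of_real (indicator \<Omega> x * c x) - indicator \<Omega> x *\<^sub>R (g x * of_real (c x)))"
    by (intro Bochner_Integration.integral_diff[symmetric] integrable_mult_right int_gc)
      (simp only: complex_of_real_integrable_eq int_c)
  finally have eq: "z * of_real J = \<dots>" .
  have int_d: "integrable lebesgue (\<lambda>x. z * of_real (indicator \<Omega> x * c x) - indicator \<Omega> x *\<^sub>R (g x * of_real (c x)))"
    by (intro Bochner_Integration.integrable_diff integrable_mult_right int_gc)
      (simp only: complex_of_real_integrable_eq int_c)
  have "cmod (z * of_real J) \<le> (LINT x|lebesgue. indicator \<Omega> x * H)"
    unfolding eq
  proof (rule Bochner_Integration.integral_norm_bound_integral[OF int_d])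
    show "integrable lebesgue (\<lambda>x. indicator \<Omega> x * H)" using int_ind by simp
    fix x
    show "cmod (z * of_real (indicator \<Omega> x * c x) - indicator \<Omega> x *\<^sub>R (g x * of_real (c x))) \<le> indicator \<Omega> x * H"
    proof (cases "x \<in> \<Omega>")
      case True
      have "cmod (z * of_real (c x) - g x * of_real (c x)) = cmod (z - g x) * \<bar>c x\<bar>"
        by (metis left_diff_distrib norm_mult norm_of_real)
      also have "\<dots> \<le> cmod (z - g x) * 1"
        using c_bounds[OF True] by (intro mult_left_mono) auto
      also have "\<dots> \<le> H" using osc[OF True] by simp
      finally show ?thesis using True by simp
    qed simp
  qed
  also have "\<dots> = m * H" using lm by (simp add: m_def)
  finally have "cmod z * J \<le> m * H" using J \<open>m > 0\<close> by (simp add: norm_mult)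
  moreover have "cmod z * (m / 2) \<le> cmod z * J" using J by (intro mult_left_mono) auto
  ultimately have "cmod z * (m / 2) \<le> m * H" by (rule order_trans[rotated])
  then have "m * cmod z \<le> m * (2 * H)" by (simp add: algebra_simps)
  then show ?thesis using \<open>m > 0\<close> by simp
qed

theorem theorem3p7:
  fixes \<alpha> D k :: real
  assumes "D > 0" and "k > 0" and "0 < \<alpha>" and "\<alpha> \<le> 1" and "CARD('n::finite) \<ge> 2"
  shows "\<exists>C>0. \<forall>(\<Omega>::(real^'n) set) V u w.
     lipschitz_domain \<Omega> \<and> bounded \<Omega> \<and> diameter \<Omega> \<le> D
     \<and> holder_on \<alpha> (closure \<Omega>) V \<and> (INF x\<in>frontier \<Omega>. cmod (V x)) > 0
     \<and> interior_transmission_eigenvalue \<Omega> V k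
     \<and> transmission_eigenfunctions \<Omega> V k u w
     \<and> holder_on \<alpha> (closure \<Omega>) u \<and> holder_norm \<alpha> (closure \<Omega>) u = 1
     \<longrightarrow> (SUP x\<in>frontier \<Omega>. cmod (u x))
          \<le> C * diameter \<Omega> powr \<alpha> * holder_norm \<alpha> (closure \<Omega>) V / (INF x\<in>frontier \<Omega>. cmod (V x))"
\<comment> \<open>The sum of the constants of the two cases: 2 when k diam \<le> 1, and
  \<open>k powr \<alpha>\<close> otherwise. It is fixed before the domain is chosen.\<close>
proof (intro exI[of _ "2 + k powr \<alpha>"] conjI allI impI)
  show "2 + k powr \<alpha> > 0" by (simp add: add_pos_nonneg)
  fix \<Omega> :: "(real^'n) set" and V u w
  assume "lipschitz_domain \<Omega> \<and> bounded \<Omega> \<and> diameter \<Omega> \<le> D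
     \<and> holder_on \<alpha> (closure \<Omega>) V \<and> (INF x\<in>frontier \<Omega>. cmod (V x)) > 0
     \<and> interior_transmission_eigenvalue \<Omega> V k
     \<and> transmission_eigenfunctions \<Omega> V k u w
     \<and> holder_on \<alpha> (closure \<Omega>) u \<and> holder_norm \<alpha> (closure \<Omega>) u = 1"
  then have lip: "lipschitz_domain \<Omega>" and bdd: "bounded \<Omega>"
    and hV: "holder_on \<alpha> (closure \<Omega>) V" and I_pos: "(INF x\<in>frontier \<Omega>. cmod (V x)) > 0"
    and te: "transmission_eigenfunctions \<Omega> V k u w"
    and hu: "holder_on \<alpha> (closure \<Omega>) u" and u1: "holder_norm \<alpha> (closure \<Omega>) u = 1"
    by blast+
  have op: "open \<Omega>" and ne: "\<Omega> \<noteq> {}" using lip by (auto simp: lipschitz_domain_def)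
  define d where "d = diameter \<Omega>"
  define N where "N = holder_norm \<alpha> (closure \<Omega>) V"
  define I where "I = (INF x\<in>frontier \<Omega>. cmod (V x))"
  have dist_d: "dist x y \<le> d" if "x \<in> closure \<Omega>" "y \<in> closure \<Omega>" for x y
    using diameter_bounded_bound[of "closure \<Omega>" x y] that bdd
    by (simp add: d_def diameter_closure bounded_closure)
  have front: "frontier \<Omega> \<subseteq> closure \<Omega>" by (simp add: frontier_def)
  have front_ne: "frontier \<Omega> \<noteq> {}"
    using ne bdd not_bounded_UNIV by (auto simp: frontier_eq_empty)
  \<comment> \<open>A point of the open set and one of its frontier are distinct, as
    \<open>holder_normE\<close> demands.\<close>
  obtain p where p: "p \<in> \<Omega>" using ne by blast
  obtain p' where p': "p' \<in> frontier \<Omega>" using front_ne by blast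
  then have pts: "p \<in> closure \<Omega>" "p' \<in> closure \<Omega>" "p \<noteq> p'"
    using p op front closure_subset by (auto simp: frontier_def interior_open)
  obtain Av Bv where V: "N = Av + Bv" "0 \<le> Av" "0 \<le> Bv"
    "\<And>x. x \<in> closure \<Omega> \<Longrightarrow> cmod (V x) \<le> Av"
    "\<And>x y. x \<in> closure \<Omega> \<Longrightarrow> y \<in> closure \<Omega> \<Longrightarrow> cmod (V x - V y) \<le> Bv * dist x y powr \<alpha>"
    using holder_normE[OF hV pts] unfolding N_def by metis
  obtain Au Bu where u: "1 = Au + Bu" "0 \<le> Au" "0 \<le> Bu"
    "\<And>x. x \<in> closure \<Omega> \<Longrightarrow> cmod (u x) \<le> Au"
    "\<And>x y. x \<in> closure \<Omega> \<Longrightarrow> y \<in> closure \<Omega> \<Longrightarrow> cmod (u x - u y) \<le> Bu * dist x y powr \<alpha>"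
    using holder_normE[OF hu pts] unfolding u1 by metis
  have contV: "continuous_on (closure \<Omega>) V" and contu: "continuous_on (closure \<Omega>) u"
    using hV hu assms(3) by (auto intro: holder_on_imp_continuous_on)
  have I_le: "I \<le> cmod (V x)" if "x \<in> frontier \<Omega>" for x
    unfolding I_def using that by (intro cINF_lower bdd_belowI2[of _ 0]) auto
  have "I > 0" using I_pos by (simp add: I_def)
  have "N \<ge> 0" using V by simp
  have bound: "cmod (u x0) \<le> (2 + k powr \<alpha>) * d powr \<alpha> * N / I" if x0: "x0 \<in> frontier \<Omega>" for x0
  proof (cases "k * d \<le> 1")
    case False
    have x0': "x0 \<in> closure \<Omega>" using x0 front by blast
    have d: "d \<ge> 0" using dist_d[OF x0' x0'] by simp
    \<comment> \<open>Here the right-hand side is already at least N/I \<ge> 1, while the Hoelder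
      norm bounds \<open>u\<close> by 1.\<close>
    have "1 \<le> (k * d) powr \<alpha>" using False assms(3) by (intro ge_one_powr_ge_zero) auto
    also have "\<dots> = k powr \<alpha> * d powr \<alpha>" using d assms(2) by (simp add: powr_mult)
    also have "\<dots> \<le> (2 + k powr \<alpha>) * d powr \<alpha>" by (intro mult_right_mono) auto
    finally have "1 \<le> (2 + k powr \<alpha>) * d powr \<alpha>" .
    moreover have "I \<le> N" using I_le[OF x0] V(4)[OF x0'] V(1,3) by linarith
    ultimately have "I \<le> (2 + k powr \<alpha>) * d powr \<alpha> * N"
      using \<open>N \<ge> 0\<close> mult_right_mono[of 1 "(2 + k powr \<alpha>) * d powr \<alpha>" N] by linarith
    then have "1 \<le> (2 + k powr \<alpha>) * d powr \<alpha> * N / I" using \<open>I > 0\<close> by simp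
    moreover have "cmod (u x0) \<le> 1" using u(1,3) u(4)[OF x0'] by linarith
    ultimately show ?thesis by linarith
  next
    case True
    have x0': "x0 \<in> closure \<Omega>" using x0 front by blast
    \<comment> \<open>Any coordinate direction will do for the cosine.\<close>
    fix i0 :: 'n
    have osc: "cmod (V x0 * u x0 - V x * u x) \<le> N * d powr \<alpha>" if "x \<in> \<Omega>" for x
    proof -
      have x: "x \<in> closure \<Omega>" using that closure_subset by blast
      have le: "dist x0 x powr \<alpha> \<le> d powr \<alpha>"
        using dist_d[OF x0' x] assms(3) by (intro powr_mono2) auto
      have "V x0 * u x0 - V x * u x = V x0 * (u x0 - u x) + (V x0 - V x) * u x"
        by (simp add: algebra_simps)
      then have "cmod (V x0 * u x0 - V x * u x) \<le> cmod (V x0) * cmod (u x0 - u x) + cmod (V x0 - V x) * cmod (u x)"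
        by (metis norm_mult norm_triangle_ineq)
      also have "\<dots> \<le> Av * (Bu * d powr \<alpha>) + (Bv * d powr \<alpha>) * Au"
      proof (intro add_mono mult_mono)
        show "cmod (u x0 - u x) \<le> Bu * d powr \<alpha>"
          using u(5)[OF x0' x] mult_left_mono[OF le u(3)] by linarith
        show "cmod (V x0 - V x) \<le> Bv * d powr \<alpha>"
          using V(5)[OF x0' x] mult_left_mono[OF le V(3)] by linarith
      qed (use V u x x0' in auto)
      also have "\<dots> = (Av * Bu + Bv * Au) * d powr \<alpha>" by (simp add: algebra_simps)
      \<comment> \<open>\<open>Au\<close> and \<open>Bu\<close> are nonnegative with sum 1, so each
        is at most 1 and the bracket is at most \<open>Av + Bv\<close>.\<close>
      also have "\<dots> \<le> N * d powr \<alpha>"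
      proof (intro mult_right_mono)
        have "Av * Bu \<le> Av" "Bv * Au \<le> Bv" using u V by (auto intro: mult_left_le)
        then show "Av * Bu + Bv * Au \<le> N" using V(1) by simp
      qed simp
      finally show ?thesis .
    qed
    have c_ge: "1 / 2 \<le> cos (k * (x $ i0 - x0 $ i0))" if "x \<in> \<Omega>" for x
    proof -
      have x: "x \<in> closure \<Omega>" using that closure_subset by blast
      have "\<bar>x $ i0 - x0 $ i0\<bar> \<le> d"
        using component_le_norm_cart[of "x - x0" i0] dist_d[OF x x0'] by (simp add: dist_norm)
      then have "k * \<bar>x $ i0 - x0 $ i0\<bar> \<le> k * d" using assms(2) by (intro mult_left_mono) auto
      \<comment> \<open>The threshold k d \<le> 1 is below pi/3, where the cosine is 1/2. Centring
        the phase at \<open>x0\<close> keeps the argument this small.\<close>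
      then have "\<bar>k * (x $ i0 - x0 $ i0)\<bar> \<le> pi / 3"
        using True assms(2) pi_gt3 unfolding abs_mult by linarith
      then have "cos (pi / 3) \<le> cos \<bar>k * (x $ i0 - x0 $ i0)\<bar>"
        by (intro cos_monotone_0_pi_le) auto
      then show ?thesis by (simp add: cos_60)
    qed
    have "cmod (V x0 * u x0) \<le> 2 * (N * d powr \<alpha>)"
    proof (rule oscillation_bound[OF op ne bdd _ _ _ c_ge _ osc])
      show "(LINT x:\<Omega>|lebesgue. V x * u x * of_real (cos (k * (x $ i0 - x0 $ i0)))) = 0"
        by (rule transmission_orthogonality[OF op bdd negligible_frontier_lipschitz_domain[OF lip] te contV contu])
    qed (auto intro!: continuous_intros contV contu)
    moreover have "I * cmod (u x0) \<le> cmod (V x0 * u x0)"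
      using I_le[OF x0] by (simp add: norm_mult mult_right_mono)
    moreover have "2 * (N * d powr \<alpha>) \<le> (2 + k powr \<alpha>) * d powr \<alpha> * N"
      using \<open>N \<ge> 0\<close> by (simp add: algebra_simps)
    ultimately have "I * cmod (u x0) \<le> (2 + k powr \<alpha>) * d powr \<alpha> * N" by linarith
    then show ?thesis using \<open>I > 0\<close> by (simp add: field_simps)
  qed
  show "(SUP x\<in>frontier \<Omega>. cmod (u x))
          \<le> (2 + k powr \<alpha>) * diameter \<Omega> powr \<alpha> * holder_norm \<alpha> (closure \<Omega>) V / (INF x\<in>frontier \<Omega>. cmod (V x))"
    using bound unfolding d_def N_def I_def by (rule cSUP_least[OF front_ne])
qed

end
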